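(* For every fixed $\varepsilon>0$ there is an algorithm which, given an instance of the Maximum Consecutive Bipartite Matching problem (a bipartite graph $G=(A\,\dot\cup\,B,E)$ with $A=\{a_1,\dots,a_n\}$, $B=\{b_1,\dots,b_n\}$), runs in time $n^{O(1/\varepsilon)}$ and outputs a consecutive matching $M$ of $G$ with $(2+\varepsilon)\cdot|M|\ge|OPT|$, where $OPT$ is a consecutive matching of $G$ of maximum cardinality.
   Context: Maximum Consecutive Bipartite Matching (MCBM): the input is an arbitrary bipartite graph $G=(A\,\dot\cup\,B,E)$ whose two sides are linearly ordered, $A=\{a_1,\dots,a_n\}$, $B=\{b_1,\dots,b_n\}$. A matching $M\subseteq E$ is called consecutive if for all $i,j,j'$: whenever $(a_i,b_j)\in M$ and $(a_{i+1},b_{j'})\in M$ then $j'=j+1$; and symmetrically, whenever $(a_i,b_j)\in M$ and $(a_{i'},b_{j+1})\in M$ then $i'=i+1$. The goal is to find a consecutive matching of maximum cardinality. An algorithm is a $(2+\varepsilon)$-approximation if its output $M$ always satisfies $(2+\varepsilon)|M|\ge|OPT|$. *)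

theory Defs
  imports Complex_Main "HOL-Library.Landau_Symbols"
begin

section \<open>Maximum consecutive bipartite matching\<close>

text \<open>
  The vertices \<open>a\<^sub>i\<close> and \<open>b\<^sub>j\<close>, with \<open>1 \<le> i, j \<le> n\<close>, are represented by their positions in
  the two linear orders; the pair \<open>(i, j)\<close> is the edge between \<open>a\<^sub>i\<close> and \<open>b\<^sub>j\<close>.
\<close>

definition bipartite_instance :: "nat \<Rightarrow> (nat \<times> nat) set \<Rightarrow> bool" where
  "bipartite_instance n E \<longleftrightarrow> E \<subseteq> {1..n} \<times> {1..n}"

definition matching :: "(nat \<times> nat) set \<Rightarrow> (nat \<times> nat) set \<Rightarrow> bool" where
  "matching E M \<longleftrightarrow> M \<subseteq> E \<and> (\<forall>i j i' j'. (i, j) \<in> M \<and> (i', j') \<in> M \<longrightarrow> (i = i' \<longleftrightarrow> j = j'))"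

definition consecutive :: "(nat \<times> nat) set \<Rightarrow> bool" where
  "consecutive M \<longleftrightarrow>
     (\<forall>i j j'. (i, j) \<in> M \<and> (i + 1, j') \<in> M \<longrightarrow> j' = j + 1) \<and>
     (\<forall>i i' j. (i, j) \<in> M \<and> (i', j + 1) \<in> M \<longrightarrow> i' = i + 1)"

definition consecutive_matching :: "(nat \<times> nat) set \<Rightarrow> (nat \<times> nat) set \<Rightarrow> bool" where
  "consecutive_matching E M \<longleftrightarrow> matching E M \<and> consecutive M"

definition max_consecutive_matching :: "(nat \<times> nat) set \<Rightarrow> (nat \<times> nat) set \<Rightarrow> bool" where
  "max_consecutive_matching E M \<longleftrightarrow>
     consecutive_matching E M \<and> (\<forall>M'. consecutive_matching E M' \<longrightarrow> card M' \<le> card M)"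

lemma max_consecutive_matching_exists:
  assumes "bipartite_instance n E"
  shows "\<exists>M. max_consecutive_matching E M"
proof -
  have fin: "finite E"
    using assms finite_subset unfolding bipartite_instance_def by blast
  have "consecutive_matching E {}"
    by (simp add: consecutive_matching_def matching_def consecutive_def)
  moreover have "card M < Suc (card E)" if "consecutive_matching E M" for M
    using that card_mono[OF fin, of M]
    by (simp add: consecutive_matching_def matching_def less_Suc_eq_le)
  ultimately show ?thesis
    using ex_has_greatest_nat[of "consecutive_matching E" "{}" card "Suc (card E)"]
    by (auto simp: max_consecutive_matching_def)
qed


section \<open>Random access machines with unit costs\<close>

text \<open>
  Algorithms are programs of a structured random access machine working on natural numbers, with
  finitely many named arrays as its memory. Every evaluation of an expression node and every
  executed assignment, test or \<open>SKIP\<close> costs one unit. Arithmetic is restricted to addition and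
  truncated subtraction: an operation lengthens a binary number by at most one bit, so unit costs
  agree with the costs on a Turing machine up to a polynomial.
\<close>

type_synonym vname = string
type_synonym state = "vname \<Rightarrow> nat \<Rightarrow> nat"

datatype aexp =
    N nat
  | Arr vname aexp
  | Plus aexp aexp
  | Minus aexp aexp

datatype bexp =
    Less aexp aexp
  | Not bexp
  | And bexp bexp

text \<open>A scalar variable is the cell of an array at index \<open>0\<close>.\<close>

abbreviation V :: "vname \<Rightarrow> aexp" where
  "V x \<equiv> Arr x (N 0)"

fun aval :: "aexp \<Rightarrow> state \<Rightarrow> nat" where
  "aval (N k) s = k"
| "aval (Arr x e) s = s x (aval e s)"
| "aval (Plus e1 e2) s = aval e1 s + aval e2 s"
| "aval (Minus e1 e2) s = aval e1 s - aval e2 s"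

fun acost :: "aexp \<Rightarrow> nat" where
  "acost (N k) = 1"
| "acost (Arr x e) = 1 + acost e"
| "acost (Plus e1 e2) = 1 + acost e1 + acost e2"
| "acost (Minus e1 e2) = 1 + acost e1 + acost e2"

fun bval :: "bexp \<Rightarrow> state \<Rightarrow> bool" where
  "bval (Less e1 e2) s \<longleftrightarrow> aval e1 s < aval e2 s"
| "bval (Not b) s \<longleftrightarrow> \<not> bval b s"
| "bval (And b1 b2) s \<longleftrightarrow> bval b1 s \<and> bval b2 s"

fun bcost :: "bexp \<Rightarrow> nat" where
  "bcost (Less e1 e2) = 1 + acost e1 + acost e2"
| "bcost (Not b) = 1 + bcost b"
| "bcost (And b1 b2) = 1 + bcost b1 + bcost b2"

datatype com =
    SKIP
  | Assign vname aexp aexp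
  | Seq com com
  | If bexp com com
  | While bexp com

text \<open>
  \<open>exec c s t s'\<close>: started in state \<open>s\<close>, the program \<open>c\<close> terminates in state \<open>s'\<close> at total cost \<open>t\<close>.
  The command \<open>Assign x e1 e2\<close> stores the value of \<open>e2\<close> in the array \<open>x\<close> at the index given by \<open>e1\<close>.
\<close>

inductive exec :: "com \<Rightarrow> state \<Rightarrow> nat \<Rightarrow> state \<Rightarrow> bool" where
  Skip: "exec SKIP s 1 s"
| Assign: "exec (Assign x e1 e2) s (1 + acost e1 + acost e2)
             (s(x := (s x)(aval e1 s := aval e2 s)))"
| Seq: "exec c1 s t1 s1 \<Longrightarrow> exec c2 s1 t2 s2 \<Longrightarrow> exec (Seq c1 c2) s (t1 + t2) s2"
| IfTrue: "bval b s \<Longrightarrow> exec c1 s t s' \<Longrightarrow> exec (If b c1 c2) s (1 + bcost b + t) s'"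
| IfFalse: "\<not> bval b s \<Longrightarrow> exec c2 s t s' \<Longrightarrow> exec (If b c1 c2) s (1 + bcost b + t) s'"
| WhileFalse: "\<not> bval b s \<Longrightarrow> exec (While b c) s (1 + bcost b) s"
| WhileTrue: "bval b s \<Longrightarrow> exec c s t1 s1 \<Longrightarrow> exec (While b c) s1 t2 s2 \<Longrightarrow>
             exec (While b c) s (1 + bcost b + t1 + t2) s2"

inductive_cases SkipE: "exec SKIP s t s'"
inductive_cases AssignE: "exec (Assign x e1 e2) s t s'"
inductive_cases SeqE: "exec (Seq c1 c2) s t s'"
inductive_cases IfE: "exec (If b c1 c2) s t s'"
inductive_cases WhileE: "exec (While b c) s t s'"

lemma exec_deterministic:
  "exec c s t s' \<Longrightarrow> exec c s u s'' \<Longrightarrow> u = t \<and> s'' = s'"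
proof (induction arbitrary: u s'' rule: exec.induct)
  case (Skip s)
  then show ?case by (auto elim: SkipE)
next
  case (Assign x e1 e2 s)
  then show ?case by (auto elim: AssignE)
next
  case (Seq c1 s t1 s1 c2 t2 s2)
  from Seq.prems obtain u1 r u2 where
    *: "u = u1 + u2" "exec c1 s u1 r" "exec c2 r u2 s''"
    by (rule SeqE)
  with Seq.IH(1)[OF *(2)] Seq.IH(2)[of u2 s''] show ?case by simp
next
  case (IfTrue b s c1 t s' c2)
  with IfTrue.prems obtain v where "u = Suc (bcost b + v)" "exec c1 s v s''"
    by (auto elim: IfE)
  with IfTrue.IH[of v s''] show ?case by simp
next
  case (IfFalse b s c2 t s' c1)
  with IfFalse.prems obtain v where "u = Suc (bcost b + v)" "exec c2 s v s''"
    by (auto elim: IfE)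
  with IfFalse.IH[of v s''] show ?case by simp
next
  case (WhileFalse b s c)
  then show ?case by (auto elim: WhileE)
next
  case (WhileTrue b s c t1 s1 t2 s2)
  from WhileTrue.prems obtain u1 r u2 where
    *: "u = Suc (bcost b + u1 + u2)" "exec c s u1 r" "exec (While b c) r u2 s''"
    by (rule WhileE) (use WhileTrue.hyps in auto)
  with WhileTrue.IH(1)[OF *(2)] WhileTrue.IH(2)[of u2 s''] show ?case by simp
qed


section \<open>Input and output\<close>

text \<open>
  Edge sets are stored as adjacency matrices: the entry for \<open>(i, j)\<close> is the cell \<open>i * n + j\<close>, and
  different pairs with \<open>1 \<le> i, j \<le> n\<close> have different cells. A program finds \<open>n\<close> in the
  scalar \<open>n\<close> and the graph in the array \<open>E\<close>, all other cells being \<open>0\<close>, and leaves its result in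
  the array \<open>M\<close>.
\<close>

definition edges_of :: "nat \<Rightarrow> (nat \<Rightarrow> nat) \<Rightarrow> (nat \<times> nat) set" where
  "edges_of n a = {(i, j). i \<in> {1..n} \<and> j \<in> {1..n} \<and> a (i * n + j) \<noteq> 0}"

definition input_state :: "nat \<Rightarrow> (nat \<times> nat) set \<Rightarrow> state" where
  "input_state n E = (\<lambda>x k. 0)
     (''n'' := (\<lambda>k. if k = 0 then n else 0),
      ''E'' := (\<lambda>k. if \<exists>(i, j) \<in> E. k = i * n + j then 1 else 0))"

definition output_edges :: "nat \<Rightarrow> state \<Rightarrow> (nat \<times> nat) set" where
  "output_edges n s = edges_of n (s ''M'')"

lemma cell_inject:
  fixes i j i' j' n :: nat
  assumes "i * n + j = i' * n + j'" "j \<in> {1..n}" "j' \<in> {1..n}"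
  shows "i = i' \<and> j = j'"
proof -
  have *: "\<not> a < a'" if "a * n + b = a' * n + b'" "b \<le> n" "1 \<le> b'" for a a' b b' :: nat
  proof
    assume "a < a'"
    then have "Suc a * n \<le> a' * n" by (intro mult_le_mono1) simp
    with that show False by simp
  qed
  have "i = i'"
    using *[of i j i' j'] *[of i' j' i j] assms by (simp add: linorder_neq_iff)
  with assms(1) show ?thesis by simp
qed

lemma edges_of_input_state:
  assumes "bipartite_instance n E"
  shows "edges_of n (input_state n E ''E'') = E"
proof (intro set_eqI iffI; clarify)
  fix i j
  assume "(i, j) \<in> edges_of n (input_state n E ''E'')"
  then obtain i' j' where *: "(i', j') \<in> E" "i * n + j = i' * n + j'" "j \<in> {1..n}"
    by (auto simp: edges_of_def input_state_def split: if_splits)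
  moreover from * assms have "j' \<in> {1..n}"
    by (auto simp: bipartite_instance_def)
  ultimately show "(i, j) \<in> E"
    using cell_inject by blast
next
  fix i j
  assume "(i, j) \<in> E"
  then have "\<exists>(i', j') \<in> E. i * n + j = i' * n + j'"
    by blast
  with \<open>(i, j) \<in> E\<close> assms show "(i, j) \<in> edges_of n (input_state n E ''E'')"
    by (auto simp: edges_of_def input_state_def bipartite_instance_def)
qed

end

theory Submission
  imports Defs
begin

text \<open>
  The algorithm is local search: starting from the empty matching, it inserts up to \<open>K = O(1/\<epsilon>)\<close> edges,
  deletes the edges in conflict with them, and keeps the result if it is larger. It remains to bound
  a locally optimal \<open>M\<close>. Delete a residue class of edges from the optimum such that its runs
  (maximal sets of consecutive edges) have length at most \<open>t = O(1/\<epsilon>)\<close>, and let \<open>P\<close> be the rest.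
  Local optimality says that every \<open>S \<subseteq> P\<close> with \<open>|S| \<le> K\<close> is in conflict with at least \<open>|S|\<close> edges of \<open>M\<close>;
  the difference of the two numbers is the surplus of \<open>S\<close>, a submodular function.

  Every edge of \<open>M\<close> has a charge of 2 to distribute among the runs that it conflicts with. There are
  at most four of them; if there are more than two, then some get only one half, and these
  conflict with the edge only through their first or last element. A run of length \<open>k\<close> then receives
  about \<open>k\<close>, up to a deficit that comes from halves; such a deficit leads to sets of surplus zero.
  If a set of surplus zero and size \<open>s \<le> t\<close> contains the end of one of two paired runs at \<open>e\<close> but not that of
  the other, then a further \<open>(1 - s/t)/2\<close> of the charge of \<open>e\<close> is moved to the former run. Since sets of surplus zero
  are closed under union, the moves into a run make up for those out of it, except for \<open>k/t\<close>.
  Decreasing the moves with the size of the set is what makes swaps of size linear in \<open>1/\<epsilon>\<close> sufficient.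
\<close>

section \<open>Charging in a locally optimal system\<close>

text \<open>Of the graph only the conflicts are kept: \<open>P\<close> stands for the shortened
  optimum and \<open>C f\<close> for the edges of the local optimum in conflict with
  \<open>f\<close>. The linear orders enter later, through the runs.\<close>

locale swap_optimal =
  fixes C :: "'f \<Rightarrow> 'e set" and P :: "'f set" and K t :: nat
  assumes finite_P: "finite P"
    and finite_C: "f \<in> P \<Longrightarrow> finite (C f)"
    and optimal: "S \<subseteq> P \<Longrightarrow> card S \<le> K \<Longrightarrow> card S \<le> card (\<Union> (C ` S))"
    and K_ge: "13 * t \<le> K"
begin

section \<open>Surplus, tight sets and relief\<close>

definition hits :: "'f set \<Rightarrow> 'e set" where "hits S = \<Union> (C ` S)"

definition surplus :: "'f set \<Rightarrow> int" where "surplus S = int (card (hits S)) - int (card S)"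

lemma finite_hits: "S \<subseteq> P \<Longrightarrow> finite (hits S)"
  unfolding hits_def using finite_C finite_P finite_subset by blast

lemma hits_Un: "hits (S \<union> T) = hits S \<union> hits T" by (auto simp: hits_def)
lemma hits_mono: "S \<subseteq> T \<Longrightarrow> hits S \<subseteq> hits T" by (auto simp: hits_def)
lemma hits_I: "f \<in> S \<Longrightarrow> e \<in> C f \<Longrightarrow> e \<in> hits S" by (auto simp: hits_def)

lemma surplus_nonneg: "S \<subseteq> P \<Longrightarrow> card S \<le> K \<Longrightarrow> 0 \<le> surplus S"
  using optimal[of S] by (simp add: surplus_def hits_def)

text \<open>The size of a union of conflict sets is submodular and \<open>card\<close> is modular.
  An edge that both \<open>X\<close> and \<open>Y\<close> hit, but \<open>X \<inter> Y\<close> does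
  not, improves the inequality by one; the set \<open>D\<close> of such edges is what later limits
  the number of moves out of a run.\<close>

lemma surplus_submodular:
  assumes "X \<subseteq> P" "Y \<subseteq> P" "D \<subseteq> hits X \<inter> hits Y" "D \<inter> hits (X \<inter> Y) = {}"
  shows "surplus (X \<union> Y) + surplus (X \<inter> Y) + int (card D) \<le> surplus X + surplus Y"
proof -
  have fX: "finite X" and fY: "finite Y" using assms finite_P finite_subset by blast+
  have fCX: "finite (hits X)" and fCY: "finite (hits Y)" using assms finite_hits by blast+
  have "hits (X \<inter> Y) \<union> D \<subseteq> hits X \<inter> hits Y" using assms by (auto simp: hits_def)
  then have "card (hits (X \<inter> Y) \<union> D) \<le> card (hits X \<inter> hits Y)"
    using fCX by (intro card_mono) auto
  moreover have "card (hits (X \<inter> Y) \<union> D) = card (hits (X \<inter> Y)) + card D"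
  proof (rule card_Un_disjoint)
    show "finite (hits (X \<inter> Y))" using finite_hits assms by blast
    show "finite D" using assms fCX finite_subset by blast
  qed (use assms in auto)
  moreover have "card (hits X) + card (hits Y) = card (hits (X \<union> Y)) + card (hits X \<inter> hits Y)"
    using card_Un_Int[OF fCX fCY] by (simp add: hits_Un)
  moreover have "card X + card Y = card (X \<union> Y) + card (X \<inter> Y)"
    using card_Un_Int[OF fX fY] .
  ultimately show ?thesis unfolding surplus_def by linarith
qed

text \<open>By \<open>surplus_nonneg\<close> the surplus is exactly zero as soon as
  \<open>card S \<le> K\<close>.\<close>

definition tight :: "'f set \<Rightarrow> bool" where "tight S \<longleftrightarrow> S \<subseteq> P \<and> surplus S \<le> 0"

text \<open>The charge moved towards the run of \<open>f\<close> from that of \<open>g\<close>, in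
  units of \<open>1 / (2 * t)\<close>: a tight set of size \<open>s\<close> that separates
  \<open>f\<close> from \<open>g\<close> moves \<open>(1 - s / t) / 2\<close>, which is
  \<open>t - s\<close> units. It is 0 if no tight set with fewer than \<open>t\<close> elements
  separates them.\<close>

definition relief :: "'f \<Rightarrow> 'f \<Rightarrow> nat" where
  "relief f g = Max (insert 0 ((\<lambda>S. t - card S) ` {S. tight S \<and> f \<in> S \<and> g \<notin> S}))"

lemma finite_tight: "finite {S. tight S \<and> f \<in> S \<and> g \<notin> S}"
  using finite_P by (auto simp: tight_def intro: finite_subset[of _ "Pow P"])

lemma relief_ge: "tight S \<Longrightarrow> f \<in> S \<Longrightarrow> g \<notin> S \<Longrightarrow> t - card S \<le> relief f g"
  unfolding relief_def using finite_tight by (intro Max_ge) auto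

lemma relief_le: "relief f g \<le> t"
  unfolding relief_def using finite_tight by (subst Max_le_iff) auto

lemma relief_pos:
  assumes "0 < relief f g"
  obtains S where "tight S" "f \<in> S" "g \<notin> S" "card S + relief f g = t"
proof -
  have "relief f g \<in> insert 0 ((\<lambda>S. t - card S) ` {S. tight S \<and> f \<in> S \<and> g \<notin> S})"
    unfolding relief_def using finite_tight by (intro Max_in) auto
  with assms that show thesis by auto
qed

lemma tight_Un:
  assumes "tight X" "tight Y" "card (X \<union> Y) \<le> K"
  shows "tight (X \<union> Y)" "tight (X \<inter> Y)"
proof -
  have sub: "X \<subseteq> P" "Y \<subseteq> P" using assms by (auto simp: tight_def)
  then have fin: "finite (X \<union> Y)" using finite_P finite_subset by blast
  have "card (X \<inter> Y) \<le> card (X \<union> Y)" using fin by (intro card_mono) auto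
  then have "0 \<le> surplus (X \<union> Y)" "0 \<le> surplus (X \<inter> Y)"
    using assms sub by (auto intro!: surplus_nonneg)
  moreover have "surplus (X \<union> Y) + surplus (X \<inter> Y) \<le> surplus X + surplus Y"
    using surplus_submodular[OF sub, of "{}"] by simp
  ultimately show "tight (X \<union> Y)" "tight (X \<inter> Y)"
    using assms sub by (auto simp: tight_def)
qed

lemma tight_UN:
  assumes "finite Z" "\<And>e. e \<in> Z \<Longrightarrow> tight (S e)" "(\<Sum>e\<in>Z. card (S e)) \<le> K"
  shows "tight (\<Union>e\<in>Z. S e)" "card (\<Union>e\<in>Z. S e) \<le> (\<Sum>e\<in>Z. card (S e))"
proof -
  have "tight (\<Union>e\<in>Z. S e) \<and> card (\<Union>e\<in>Z. S e) \<le> (\<Sum>e\<in>Z. card (S e))"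
    using assms
  proof (induction Z)
    case empty
    then show ?case by (simp add: tight_def surplus_def hits_def)
  next
    case (insert x Z)
    then have IH: "tight (\<Union>e\<in>Z. S e)" "card (\<Union>e\<in>Z. S e) \<le> (\<Sum>e\<in>Z. card (S e))" by auto
    have "card (S x \<union> (\<Union>e\<in>Z. S e)) \<le> card (S x) + card (\<Union>e\<in>Z. S e)" by (rule card_Un_le)
    then have "card (S x \<union> (\<Union>e\<in>Z. S e)) \<le> (\<Sum>e\<in>insert x Z. card (S e))"
      using IH insert.hyps by simp
    then show ?case using tight_Un(1)[of "S x" "\<Union>e\<in>Z. S e"] IH insert.prems by simp
  qed
  then show "tight (\<Union>e\<in>Z. S e)" "card (\<Union>e\<in>Z. S e) \<le> (\<Sum>e\<in>Z. card (S e))" by auto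
qed

section \<open>Uncrossing a run with tight sets\<close>

text \<open>In the applications \<open>I\<close> is a run with ends \<open>a\<close> and
  \<open>b\<close>, or such a run without one end, and \<open>GL\<close> and \<open>GR\<close> are
  edges that it hits only through \<open>a\<close> or only through \<open>b\<close>. Adding a tight
  set that avoids \<open>a\<close> uses up one unit of surplus for every edge of \<open>GL\<close>
  that it hits: the edge is hit by both sets, but not by their intersection.\<close>

lemma absorb:
  assumes I: "I \<subseteq> P" and UL: "tight UL" and UR: "tight UR"
    and size: "card (I \<union> UL \<union> UR) \<le> K"
    and a: "a \<notin> UL" and b: "b \<notin> UR"
    and GL: "GL \<subseteq> hits I" "GL \<inter> hits (I - {a}) = {}"
    and GR: "GR \<subseteq> hits I" "GR \<inter> hits (I - {b}) = {}"
    and disj: "GL \<inter> GR = {}"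
  shows "surplus (I \<union> UL \<union> UR) + surplus (I \<inter> UR \<union> UL \<inter> UR) + int (card (GL \<inter> hits UL)) + int (card (GR \<inter> hits UR)) \<le> surplus I"
proof -
  \<comment> \<open>The common part is added first. It avoids both \<open>a\<close> and
    \<open>b\<close>, so the edges of \<open>GL\<close> and \<open>GR\<close> that it hits are
    counted together. Later some of them would be lost, as \<open>UL\<close> may contain
    \<open>b\<close>, and \<open>(I \<union> UL) \<inter> UR\<close> contains
    \<open>W\<close>.\<close>
  define W where "W = UL \<inter> UR"
  have sub: "UL \<subseteq> P" "UR \<subseteq> P" "W \<subseteq> P" using UL UR by (auto simp: tight_def W_def)
  have fin: "finite (I \<union> UL \<union> UR)" using I sub finite_P by (meson finite_subset le_sup_iff)
  have small: "card S \<le> K" if "S \<subseteq> I \<union> UL \<union> UR" for S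
    using card_mono[OF fin that] size by linarith
  have "tight W" unfolding W_def by (rule tight_Un(2)[OF UL UR]) (rule small, blast)
  then have surplusW: "surplus W \<le> 0" and surplusL: "surplus UL \<le> 0" and surplusR: "surplus UR \<le> 0" using UL UR by (auto simp: tight_def)
  have fG: "finite GL" "finite GR" using GL GR finite_hits[OF I] finite_subset by blast+
  have far_L: "GL \<inter> hits (I \<inter> X) = {}" if "a \<notin> X" for X
    using GL(2) hits_mono[of "I \<inter> X" "I - {a}"] that by blast
  have far_R: "GR \<inter> hits (I \<inter> X) = {}" if "b \<notin> X" for X
    using GR(2) hits_mono[of "I \<inter> X" "I - {b}"] that by blast
  have WL: "hits W \<subseteq> hits UL" and WR: "hits W \<subseteq> hits UR" unfolding W_def by (intro hits_mono Int_lower1 Int_lower2)+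
  have 1: "surplus (I \<union> W) + surplus (I \<inter> W) + int (card ((GL \<union> GR) \<inter> hits W)) \<le> surplus I + surplus W"
  proof (rule surplus_submodular[OF I sub(3)])
    show "(GL \<union> GR) \<inter> hits W \<subseteq> hits I \<inter> hits W" using GL GR by blast
    show "(GL \<union> GR) \<inter> hits W \<inter> hits (I \<inter> W) = {}"
      using far_L[of W] far_R[of W] a b by (auto simp: W_def)
  qed
  have "surplus ((I \<union> W) \<union> UL) + surplus ((I \<union> W) \<inter> UL) + int (card (GL \<inter> hits UL - hits W)) \<le> surplus (I \<union> W) + surplus UL"
  proof (rule surplus_submodular)
    have *: "(I \<union> W) \<inter> UL = (I \<inter> UL) \<union> W" by (auto simp: W_def)
    show "(GL \<inter> hits UL - hits W) \<inter> hits ((I \<union> W) \<inter> UL) = {}"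
      unfolding * hits_Un using far_L[OF a] by blast
    show "GL \<inter> hits UL - hits W \<subseteq> hits (I \<union> W) \<inter> hits UL" using GL by (auto simp: hits_Un)
  qed (use I sub in auto)
  moreover have "(I \<union> W) \<union> UL = I \<union> UL" by (auto simp: W_def)
  ultimately have 2: "surplus (I \<union> UL) + surplus ((I \<union> W) \<inter> UL) + int (card (GL \<inter> hits UL - hits W)) \<le> surplus (I \<union> W) + surplus UL"
    by simp
  have *: "(I \<union> UL) \<inter> UR = I \<inter> UR \<union> UL \<inter> UR" by auto
  have 3: "surplus (I \<union> UL \<union> UR) + surplus ((I \<union> UL) \<inter> UR) + int (card (GR \<inter> hits UR - hits W)) \<le> surplus (I \<union> UL) + surplus UR"
  proof (rule surplus_submodular)
    show "(GR \<inter> hits UR - hits W) \<inter> hits ((I \<union> UL) \<inter> UR) = {}"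
      unfolding * hits_Un using far_R[OF b] by (auto simp: W_def)
    show "GR \<inter> hits UR - hits W \<subseteq> hits (I \<union> UL) \<inter> hits UR" using GR by (auto simp: hits_Un)
  qed (use I sub in auto)
  have "card (GL \<inter> hits UL) + card (GR \<inter> hits UR) =
      card ((GL \<union> GR) \<inter> hits W) + card (GL \<inter> hits UL - hits W) + card (GR \<inter> hits UR - hits W)"
  proof -
    have "card (GL \<inter> hits UL) = card (GL \<inter> hits W) + card (GL \<inter> hits UL - hits W)"
      using WL fG by (subst card_Un_disjoint[symmetric]) (auto intro!: arg_cong[of _ _ card])
    moreover have "card (GR \<inter> hits UR) = card (GR \<inter> hits W) + card (GR \<inter> hits UR - hits W)"
      using WR fG by (subst card_Un_disjoint[symmetric]) (auto intro!: arg_cong[of _ _ card])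
    moreover have "card ((GL \<union> GR) \<inter> hits W) = card (GL \<inter> hits W) + card (GR \<inter> hits W)"
      using disj fG by (subst card_Un_disjoint[symmetric]) (auto intro!: arg_cong[of _ _ card])
    ultimately show ?thesis by linarith
  qed
  moreover have "0 \<le> surplus (I \<inter> W)" "0 \<le> surplus ((I \<union> W) \<inter> UL)"
    using sub by (auto intro!: surplus_nonneg small simp: W_def)
  ultimately show ?thesis using 1 2 3 surplusW surplusL surplusR unfolding * by linarith
qed

text \<open>When the edges of \<open>ZL\<close> and \<open>ZR\<close> use up the whole surplus of
  \<open>I\<close>, the sets \<open>I \<union> UL \<union> UR\<close> and
  \<open>(I \<union> UL) \<inter> UR\<close> are tight, and one of them separates \<open>a\<close>
  from the partner \<open>q\<close> at a further edge \<open>j\<close>. So a run that has to give at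
  many edges receives something at another one.\<close>

lemma propagate:
  assumes I: "I \<subseteq> P" and UL: "tight UL" and UR: "tight UR"
    and size: "card (I \<union> UL \<union> UR) \<le> K"
    and a: "a \<notin> UL" and b: "b \<notin> UR"
    and GL: "GL \<subseteq> hits I" "GL \<inter> hits (I - {a}) = {}"
    and GR: "GR \<subseteq> hits I" "GR \<inter> hits (I - {b}) = {}"
    and disj: "GL \<inter> GR = {}"
    and Z: "ZL \<subseteq> GL \<inter> hits UL" "ZR \<subseteq> GR \<inter> hits UR" "int (card ZL + card ZR) = surplus I"
    and j: "j \<in> GL - ZL" "j \<in> C q" "q \<notin> I" and aI: "a \<in> I"
  shows "\<exists>S. tight S \<and> a \<in> S \<and> q \<notin> S \<and> card S \<le> card (I \<union> UL \<union> UR)"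
proof -
  have sub: "UL \<subseteq> P" "UR \<subseteq> P" using UL UR by (auto simp: tight_def)
  have fin: "finite (I \<union> UL \<union> UR)" using I sub finite_P by (meson finite_subset le_sup_iff)
  have small: "card S \<le> K" if "S \<subseteq> I \<union> UL \<union> UR" for S
    using card_mono[OF fin that] size by linarith
  have fG: "finite GL" "finite GR" using GL GR finite_hits[OF I] finite_subset by blast+
  \<comment> \<open>If such a set hit \<open>j\<close>, then \<open>absorb\<close> would count one
    edge more than the surplus of \<open>I\<close> allows.\<close>
  have no_j: "j \<notin> hits V" if V: "tight V" "a \<notin> V" "UL \<subseteq> V" "V \<subseteq> I \<union> UL \<union> UR" for V
  proof
    assume jV: "j \<in> hits V"
    have "I \<union> V \<union> UR = I \<union> UL \<union> UR" using V by auto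
    then have "surplus (I \<union> UL \<union> UR) + surplus (I \<inter> UR \<union> V \<inter> UR) + int (card (GL \<inter> hits V)) + int (card (GR \<inter> hits UR)) \<le> surplus I"
      using absorb[OF I V(1) UR _ V(2) b GL GR disj] size by simp
    moreover have "0 \<le> surplus (I \<union> UL \<union> UR)" "0 \<le> surplus (I \<inter> UR \<union> V \<inter> UR)"
      using I sub by (auto intro!: surplus_nonneg small)
    moreover have "card (insert j ZL) \<le> card (GL \<inter> hits V)"
      using Z j jV fG hits_mono[OF V(3)] by (intro card_mono) auto
    moreover have "card (insert j ZL) = Suc (card ZL)"
      using Z j fG by (subst card_insert_disjoint) (auto intro: finite_subset)
    moreover have "card ZR \<le> card (GR \<inter> hits UR)"
      using Z fG by (intro card_mono) auto
    ultimately show False using Z(3) by linarith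
  qed
  have main: "surplus (I \<union> UL \<union> UR) + surplus (I \<inter> UR \<union> UL \<inter> UR) + int (card (GL \<inter> hits UL)) + int (card (GR \<inter> hits UR)) \<le> surplus I"
    by (rule absorb[OF I UL UR size a b GL GR disj])
  have "card ZL \<le> card (GL \<inter> hits UL)" "card ZR \<le> card (GR \<inter> hits UR)"
    using Z fG by (auto intro!: card_mono)
  moreover have "0 \<le> surplus (I \<union> UL \<union> UR)" "0 \<le> surplus (I \<inter> UR \<union> UL \<inter> UR)"
    using I sub by (auto intro!: surplus_nonneg small)
  ultimately have z: "surplus (I \<union> UL \<union> UR) \<le> 0" "surplus (I \<inter> UR \<union> UL \<inter> UR) \<le> 0"
    using main Z(3) by linarith+
  have q: "q \<notin> UL" using no_j[OF UL a] j(2) by (auto intro: hits_I)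
  show ?thesis
  proof (cases "q \<in> UR")
    case False
    with z q j aI I sub show ?thesis by (intro exI[of _ "I \<union> UL \<union> UR"]) (auto simp: tight_def)
  next
    case True
    \<comment> \<open>Otherwise the tight set \<open>UL \<union> UR\<close> would avoid
      \<open>a\<close> and hit \<open>j\<close> through \<open>q\<close>. Hence
      \<open>(I \<union> UL) \<inter> UR\<close> contains \<open>a\<close>, and it avoids
      \<open>q\<close>, which is neither in \<open>I\<close> nor in \<open>UL\<close>.\<close>
    have "a \<in> UR"
    proof (rule ccontr)
      assume "a \<notin> UR"
      moreover have "tight (UL \<union> UR)" by (rule tight_Un(1)[OF UL UR]) (rule small, blast)
      ultimately have "j \<notin> hits (UL \<union> UR)" using a by (intro no_j) auto
      with True j(2) show False by (auto intro: hits_I)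
    qed
    moreover have "card (I \<inter> UR \<union> UL \<inter> UR) \<le> card (I \<union> UL \<union> UR)"
      using fin by (intro card_mono) auto
    ultimately show ?thesis using z q j aI I sub
      by (intro exI[of _ "I \<inter> UR \<union> UL \<inter> UR"]) (auto simp: tight_def)
  qed
qed

section \<open>Charge of a single run and of all runs\<close>

text \<open>Here \<open>own e\<close> is the end of the run at \<open>e\<close>, and
  \<open>q e\<close> is the end of the run paired with it. Every outgoing move belongs to a tight
  set, and by \<open>absorb\<close> at most \<open>surplus I\<close> edges have one. If there are
  fewer, it suffices to bound each move by \<open>t\<close>. If there are exactly so many,
  \<open>propagate\<close> yields an incoming move at another edge; it is large enough because each
  outgoing move and the size of its tight set add up to \<open>t\<close>.\<close>

lemma transfer_bound:
  fixes own q :: "'e \<Rightarrow> 'f"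
  assumes I: "I \<subseteq> P" "card I \<le> t"
    and GL: "GL \<subseteq> hits I" "GL \<inter> hits (I - {a}) = {}" "GL \<noteq> {} \<Longrightarrow> a \<in> I" "\<And>e. e \<in> GL \<Longrightarrow> own e = a"
    and GR: "GR \<subseteq> hits I" "GR \<inter> hits (I - {b}) = {}" "GR \<noteq> {} \<Longrightarrow> b \<in> I" "\<And>e. e \<in> GR \<Longrightarrow> own e = b"
    and disj: "GL \<inter> GR = {}" and G: "G = GL \<union> GR" "card G \<le> 12"
    and q: "\<And>e. e \<in> G \<Longrightarrow> e \<in> C (q e) \<and> q e \<notin> I"
    and less: "surplus I < int (card G)"
  shows "int t * (1 - surplus I) - int (card I) \<le> (\<Sum>e\<in>G. int (relief (own e) (q e)) - int (relief (q e) (own e)))"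
proof -
  define z where "z e = relief (q e) (own e)" for e
  define Z where "Z = {e \<in> G. 0 < z e}"
  have "\<forall>e. \<exists>S. e \<in> Z \<longrightarrow> tight S \<and> q e \<in> S \<and> own e \<notin> S \<and> card S + z e = t"
    unfolding Z_def z_def using relief_pos by (metis (lifting) mem_Collect_eq)
  then obtain S where S: "\<And>e. e \<in> Z \<Longrightarrow> tight (S e) \<and> q e \<in> S e \<and> own e \<notin> S e \<and> card (S e) + z e = t"
    by metis
  have fG: "finite G" unfolding G using GL GR finite_hits[OF I(1)] finite_subset by blast
  then have fZ: "finite Z" "finite (GL \<inter> Z)" "finite (GR \<inter> Z)" by (auto simp: Z_def)
  have ZG: "Z \<subseteq> G" by (auto simp: Z_def)
  \<comment> \<open>The run and at most 12 tight sets have at most \<open>t\<close> elements each,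
    which is the origin of the 13 in the bound on \<open>K\<close>.\<close>
  have total: "card I + (\<Sum>e\<in>Z. card (S e)) \<le> K"
  proof -
    have "card (S e) \<le> t" if "e \<in> Z" for e
      using S[OF that] by linarith
    then have "(\<Sum>e\<in>Z. card (S e)) \<le> card Z * t"
      using sum_bounded_above[of Z "\<lambda>e. card (S e)" t] by simp
    also have "\<dots> \<le> 12 * t"
      using card_mono[OF fG ZG] G by (intro mult_right_mono) auto
    finally show ?thesis using I K_ge by linarith
  qed
  define UL where "UL = (\<Union>e\<in>GL \<inter> Z. S e)"
  define UR where "UR = (\<Union>e\<in>GR \<inter> Z. S e)"
  have split: "Z = (GL \<inter> Z) \<union> (GR \<inter> Z)" using ZG G by auto
  have sums: "(\<Sum>e\<in>Z. card (S e)) = (\<Sum>e\<in>GL \<inter> Z. card (S e)) + (\<Sum>e\<in>GR \<inter> Z. card (S e))"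
    using fZ disj by (subst split, subst sum.union_disjoint) auto
  have UL: "tight UL" "card UL \<le> (\<Sum>e\<in>GL \<inter> Z. card (S e))"
    unfolding UL_def using S fZ total sums by (auto intro!: tight_UN)
  have UR: "tight UR" "card UR \<le> (\<Sum>e\<in>GR \<inter> Z. card (S e))"
    unfolding UR_def using S fZ total sums by (auto intro!: tight_UN)
  have size': "card (I \<union> UL \<union> UR) \<le> card I + (\<Sum>e\<in>Z. card (S e))"
    using UL UR sums card_Un_le[of "I \<union> UL" UR] card_Un_le[of I UL] by linarith
  then have size: "card (I \<union> UL \<union> UR) \<le> K" using total by linarith
  have a: "a \<notin> UL" and b: "b \<notin> UR"
    unfolding UL_def UR_def using S GL(4) GR(4) by fastforce+
  have ZL: "GL \<inter> Z \<subseteq> GL \<inter> hits UL" and ZR: "GR \<inter> Z \<subseteq> GR \<inter> hits UR"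
    using S q ZG unfolding UL_def UR_def hits_def by blast+
  have cardZ: "card Z = card (GL \<inter> Z) + card (GR \<inter> Z)"
    using fZ disj by (subst split, subst card_Un_disjoint) auto
  have fGLR: "finite GL" "finite GR" using fG G by auto
  have "surplus (I \<union> UL \<union> UR) + surplus (I \<inter> UR \<union> UL \<inter> UR) + int (card (GL \<inter> hits UL)) + int (card (GR \<inter> hits UR)) \<le> surplus I"
    by (rule absorb[OF I(1) UL(1) UR(1) size a b GL(1,2) GR(1,2) disj])
  moreover have "card (GL \<inter> Z) \<le> card (GL \<inter> hits UL)" "card (GR \<inter> Z) \<le> card (GR \<inter> hits UR)"
    using ZL ZR fGLR by (auto intro!: card_mono)
  moreover have "0 \<le> surplus (I \<union> UL \<union> UR)" "0 \<le> surplus (I \<inter> UR \<union> UL \<inter> UR)"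
  proof -
    have sub: "I \<union> UL \<union> UR \<subseteq> P" using I UL(1) UR(1) by (auto simp: tight_def)
    then have fin: "finite (I \<union> UL \<union> UR)" using finite_P finite_subset by blast
    show "0 \<le> surplus (I \<union> UL \<union> UR)" by (rule surplus_nonneg[OF sub size])
    have "card (I \<inter> UR \<union> UL \<inter> UR) \<le> card (I \<union> UL \<union> UR)"
      using fin by (intro card_mono) auto
    then show "0 \<le> surplus (I \<inter> UR \<union> UL \<inter> UR)" using sub size by (intro surplus_nonneg) auto
  qed
  ultimately have le: "int (card Z) \<le> surplus I" using cardZ by linarith
  have sum_z: "(\<Sum>e\<in>G. int (z e)) = (\<Sum>e\<in>Z. int (z e))"
    using fG by (intro sum.mono_neutral_right) (auto simp: Z_def)
  have z_le: "(\<Sum>e\<in>Z. int (z e)) \<le> int (card Z) * int t"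
    using sum_bounded_above[of Z "\<lambda>e. int (z e)" "int t"] relief_le by (simp add: z_def)
  have split_sum: "(\<Sum>e\<in>G. int (relief (own e) (q e)) - int (relief (q e) (own e))) =
      (\<Sum>e\<in>G. int (relief (own e) (q e))) - (\<Sum>e\<in>Z. int (z e))"
    using sum_z by (simp add: sum_subtractf z_def)
  show ?thesis
  proof (cases "int (card Z) = surplus I")
    case False
    then have "int t * int (card Z) \<le> int t * (surplus I - 1)" using le by (intro mult_left_mono) auto
    moreover have "0 \<le> (\<Sum>e\<in>G. int (relief (own e) (q e)))" by (intro sum_nonneg) auto
    ultimately show ?thesis unfolding split_sum using z_le by (simp add: algebra_simps)
  next
    case True
    then have "Z \<noteq> G" using less by auto
    then obtain j where j: "j \<in> G" "j \<notin> Z" using ZG by auto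
    have "\<exists>S. tight S \<and> own j \<in> S \<and> q j \<notin> S \<and> card S \<le> card (I \<union> UL \<union> UR)"
    proof (cases "j \<in> GL")
      case jL: True
      then show ?thesis
        using propagate[OF I(1) UL(1) UR(1) size a b GL(1,2) GR(1,2) disj ZL ZR, of j "q j"]
          True cardZ j q[OF j(1)] GL(3,4) by auto
    next
      case False
      then have jR: "j \<in> GR" using j G by auto
      have comm: "I \<union> UR \<union> UL = I \<union> UL \<union> UR" by auto
      show ?thesis
        using propagate[OF I(1) UR(1) UL(1) _ b a GR(1,2) GL(1,2) _ ZR ZL, of j "q j"]
          True cardZ j jR q[OF j(1)] GR(3,4) size disj unfolding comm by (auto simp: add.commute Int_commute)
    qed
    then obtain T where T: "tight T" "own j \<in> T" "q j \<notin> T" "card T \<le> card (I \<union> UL \<union> UR)" by auto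
    have "t - card T \<le> relief (own j) (q j)" by (rule relief_ge) (use T in auto)
    then have "int t - int (card I) - (\<Sum>e\<in>Z. int (card (S e))) \<le> int (relief (own j) (q j))"
      using T(4) size' by (simp flip: of_nat_sum)
    also have "\<dots> \<le> (\<Sum>e\<in>G. int (relief (own e) (q e)))"
      using fG j by (intro member_le_sum) auto
    finally have "int t - int (card I) - (\<Sum>e\<in>Z. int (card (S e))) \<le> (\<Sum>e\<in>G. int (relief (own e) (q e)))" .
    moreover have "(\<Sum>e\<in>Z. int (card (S e))) + (\<Sum>e\<in>Z. int (z e)) = int (card Z) * int t"
    proof -
      have "(\<Sum>e\<in>Z. int (card (S e)) + int (z e)) = (\<Sum>e\<in>Z. int t)"
        using S by (intro sum.cong) (auto simp flip: of_nat_add)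
      then show ?thesis by (simp add: sum.distrib)
    qed
    ultimately show ?thesis unfolding split_sum using True by (simp add: algebra_simps)
  qed
qed

text \<open>
  If \<open>|G|\<close> exceeds the surplus of the run by at least two, then cutting off one end of the run, together
  with the part of \<open>G\<close> there, leaves a surplus below the number of the elements of \<open>G\<close> at the
  other end, and the transfers at the two ends can be bounded separately.
\<close>

lemma run_charge:
  fixes own q :: "'e \<Rightarrow> 'f"
  assumes R: "R \<subseteq> P" "card R \<le> t" "a \<in> R" "b \<in> R" "a = b \<Longrightarrow> R = {a}"
    and G: "finite G" "card G \<le> 12"
    and own: "\<And>e. e \<in> G \<Longrightarrow> own e \<in> {a, b} \<and> e \<in> C (own e) \<and> e \<notin> hits (R - {own e})"
    and q: "\<And>e. e \<in> G \<Longrightarrow> e \<in> C (q e) \<and> q e \<notin> R"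
  shows "2 * int t * int (card R) - 2 * int (card R) \<le>
    2 * int t * int (card (hits R)) + (\<Sum>e\<in>G. int (relief (own e) (q e)) - int (relief (q e) (own e)) - int t)"
proof -
  define GL where "GL = {e \<in> G. own e = a}"
  define GR where "GR = G - GL"
  have G_eq: "G = GL \<union> GR" and disj: "GL \<inter> GR = {}" by (auto simp: GL_def GR_def)
  have sub: "GL \<subseteq> hits R" "GR \<subseteq> hits R"
    using own R(3,4) by (fastforce simp: GL_def GR_def hits_def)+
  have far: "GL \<inter> hits (R - {a}) = {}" "GR \<inter> hits (R - {b}) = {}"
    using own by (fastforce simp: GL_def GR_def)+
  have ownR: "own e = b \<and> a \<noteq> b" if "e \<in> GR" for e using own that by (auto simp: GL_def GR_def)
  have ownL: "own e = a" if "e \<in> GL" for e using that by (auto simp: GL_def)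
  have fin: "finite GL" "finite GR" using G by (auto simp: GL_def GR_def)
  define d where "d = surplus R"
  define g where "g = int (card G)"
  let ?T = "\<lambda>e. int (relief (own e) (q e)) - int (relief (q e) (own e))"
  \<comment> \<open>In units of \<open>1 / (2 * t)\<close> a full share of an edge is
    \<open>2 * t\<close>, the missing half is \<open>t\<close>, and all moves are integers. With the
    surplus \<open>d\<close> and the number \<open>g\<close> of halved edges, the charge lacking
    from \<open>card R\<close> becomes visible.\<close>
  have goal: "?thesis \<longleftrightarrow> - 2 * int (card R) \<le> 2 * int t * d - int t * g + (\<Sum>e\<in>G. ?T e)"
    by (simp add: d_def g_def surplus_def sum_subtractf sum.distrib algebra_simps)
  consider "g \<le> d" | "g = d + 1" | "d + 2 \<le> g" by linarith
  then show ?thesis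
  proof cases
    case 1
    \<comment> \<open>Here the surplus pays for the missing half and for an outgoing move of at most
      another half at each of the \<open>g\<close> edges.\<close>
    have "(\<Sum>e\<in>G. - int t) \<le> (\<Sum>e\<in>G. ?T e)"
      using relief_le by (intro sum_mono) (smt (verit) of_nat_0_le_iff of_nat_mono)
    then have "- (g * int t) \<le> (\<Sum>e\<in>G. ?T e)" by (simp add: g_def)
    moreover have "int t * g \<le> int t * d" using 1 by (intro mult_left_mono) auto
    ultimately show ?thesis unfolding goal by (simp add: algebra_simps)
  next
    case 2
    have "int t * (1 - surplus R) - int (card R) \<le> (\<Sum>e\<in>G. ?T e)"
      by (rule transfer_bound[OF R(1,2) sub(1) far(1) _ _ sub(2) far(2) _ _ disj G_eq G(2)])
        (use R q ownL ownR 2 in \<open>auto simp: d_def g_def\<close>)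
    then show ?thesis unfolding goal using 2 by (simp add: d_def algebra_simps)
  next
    case 3
    have fR: "finite R" using R finite_P finite_subset by blast
    have fC: "finite (hits R)" using R finite_hits by blast
    \<comment> \<open>A run of one element hits only \<open>d + 1\<close> edges, too few for the set
      \<open>G\<close> in this case.\<close>
    have ab: "a \<noteq> b"
    proof
      assume "a = b"
      then have "card R = 1" using R(5) by simp
      moreover have "card G \<le> card (hits R)" using sub G_eq fC by (auto intro!: card_mono)
      ultimately show False using 3 by (simp add: d_def g_def surplus_def)
    qed
    have gsum: "g = int (card GL) + int (card GR)"
      unfolding g_def G_eq using fin disj by (simp add: card_Un_disjoint)
    \<comment> \<open>Cutting off \<open>x\<close> loses one element, but also all the edges of
      \<open>H\<close>.\<close>
    have drop: "surplus (R - {x}) \<le> d + 1 - int (card H)" if "x \<in> R" "H \<subseteq> hits R" "H \<inter> hits (R - {x}) = {}" for x H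
    proof -
      have "card (hits (R - {x}) \<union> H) = card (hits (R - {x})) + card H"
        using that fC R finite_hits[of "R - {x}"] by (intro card_Un_disjoint) (auto intro: finite_subset)
      moreover have "card (hits (R - {x}) \<union> H) \<le> card (hits R)"
        using that fC hits_mono[of "R - {x}" R] by (intro card_mono) auto
      moreover have "card R = Suc (card (R - {x}))" using that fR by (metis card_Suc_Diff1)
      ultimately show ?thesis unfolding d_def surplus_def by linarith
    qed
    have dL: "surplus (R - {b}) \<le> d + 1 - int (card GR)" by (rule drop[OF R(4) sub(2) far(2)])
    have dR: "surplus (R - {a}) \<le> d + 1 - int (card GL)" by (rule drop[OF R(3) sub(1) far(1)])
    have cards: "card (R - {a}) \<le> card R" "card (R - {b}) \<le> card R" using fR by (auto intro: card_mono)
    have L: "int t * (1 - surplus (R - {b})) - int (card (R - {b})) \<le> (\<Sum>e\<in>GL. ?T e)"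
    proof (rule transfer_bound[where GL = GL and GR = "{}" and a = a and b = b])
      show "GL \<subseteq> hits (R - {b})"
      proof
        fix e assume "e \<in> GL"
        then have "e \<in> C a" using own[of e] by (auto simp: GL_def)
        then show "e \<in> hits (R - {b})" using R ab by (auto intro: hits_I)
      qed
      show "GL \<inter> hits (R - {b} - {a}) = {}" using far(1) hits_mono[of "R - {b} - {a}" "R - {a}"] by blast
      show "card GL \<le> 12" using G card_mono[OF G(1), of GL] G_eq by auto
      show "surplus (R - {b}) < int (card GL)" using dL 3 gsum by linarith
    qed (use R ab q ownL cards G_eq in auto)
    have R: "int t * (1 - surplus (R - {a})) - int (card (R - {a})) \<le> (\<Sum>e\<in>GR. ?T e)"
    proof (rule transfer_bound[where GL = "{}" and GR = GR and a = a and b = b])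
      show "GR \<subseteq> hits (R - {a})"
      proof
        fix e assume "e \<in> GR"
        then have "e \<in> C b" using own[of e] ownR[of e] by (auto simp: GR_def)
        then show "e \<in> hits (R - {a})" using R ab by (auto intro: hits_I)
      qed
      show "GR \<inter> hits (R - {a} - {b}) = {}" using far(2) hits_mono[of "R - {a} - {b}" "R - {b}"] by blast
      show "card GR \<le> 12" using G card_mono[OF G(1), of GR] G_eq by auto
      show "surplus (R - {a}) < int (card GR)" using dR 3 gsum by linarith
    qed (use R ab q ownR cards G_eq in auto)
    have "int t * (1 - (d + 1 - int (card GR))) \<le> int t * (1 - surplus (R - {b}))"
      using dL by (intro mult_left_mono) auto
    moreover have "int t * (1 - (d + 1 - int (card GL))) \<le> int t * (1 - surplus (R - {a}))"
      using dR by (intro mult_left_mono) auto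
    moreover have "(\<Sum>e\<in>G. ?T e) = (\<Sum>e\<in>GL. ?T e) + (\<Sum>e\<in>GR. ?T e)"
      unfolding G_eq using fin disj by (rule sum.union_disjoint)
    ultimately show ?thesis unfolding goal gsum using L R cards by (simp add: algebra_simps)
  qed
qed

text \<open>The set \<open>H e\<close> consists of the runs that get only a half of
  \<open>e\<close>, and \<open>\<pi> e\<close> pairs them up; by the bound on
  \<open>card (H e)\<close> the shares of \<open>e\<close> amount to at most 2. In the sum of
  \<open>run_charge\<close> over all runs the moves cancel within each pair, and what remains is a
  double count of the shares.\<close>

lemma charging:
  fixes R :: "'s \<Rightarrow> 'f set" and H :: "'e \<Rightarrow> 's set" and own :: "'e \<Rightarrow> 's \<Rightarrow> 'f"
  assumes M: "finite M" "\<And>f. f \<in> P \<Longrightarrow> C f \<subseteq> M"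
    and X: "finite X" "P = (\<Union>s\<in>X. R s)" "\<And>s s'. s \<in> X \<Longrightarrow> s' \<in> X \<Longrightarrow> s \<noteq> s' \<Longrightarrow> R s \<inter> R s' = {}"
    and R: "\<And>s. s \<in> X \<Longrightarrow> card (R s) \<le> t \<and> a s \<in> R s \<and> b s \<in> R s \<and> (a s = b s \<longrightarrow> R s = {a s})"
    and few: "\<And>s. s \<in> X \<Longrightarrow> card {e \<in> M. s \<in> H e} \<le> 12"
    and H: "\<And>e. e \<in> M \<Longrightarrow> H e \<subseteq> X \<and> 2 * card {s \<in> X. e \<in> hits (R s)} \<le> 4 + card (H e)"
    and own: "\<And>e s. e \<in> M \<Longrightarrow> s \<in> H e \<Longrightarrow>
       own e s \<in> {a s, b s} \<and> e \<in> C (own e s) \<and> e \<notin> hits (R s - {own e s})"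
    and \<pi>: "\<And>e s. e \<in> M \<Longrightarrow> s \<in> H e \<Longrightarrow> \<pi> e s \<in> H e \<and> \<pi> e s \<noteq> s \<and> \<pi> e (\<pi> e s) = s"
  shows "(int t - 1) * int (card P) \<le> 2 * int t * int (card M)"
proof -
  define T where "T e s = int (relief (own e s) (own e (\<pi> e s))) - int (relief (own e (\<pi> e s)) (own e s)) - int t" for e s
  define G where "G s = {e \<in> M. s \<in> H e}" for s
  have sub: "R s \<subseteq> P" if "s \<in> X" for s using X that by auto
  have fR: "finite (R s)" if "s \<in> X" for s using sub[OF that] finite_P finite_subset by blast
  have ownR: "own e s \<in> R s" if "e \<in> M" "s \<in> H e" for e s
    using own[OF that] R[of s] H[OF that(1)] that by auto
  have "2 * int t * int (card (R s)) - 2 * int (card (R s)) \<le>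
      2 * int t * int (card (hits (R s))) + (\<Sum>e\<in>G s. T e s)" if s: "s \<in> X" for s
    unfolding T_def
  proof (rule run_charge[of "R s" "a s" "b s"])
    show "finite (G s)" "card (G s) \<le> 12" using M(1) few[OF s] by (auto simp: G_def)
    show "own e s \<in> {a s, b s} \<and> e \<in> C (own e s) \<and> e \<notin> hits (R s - {own e s})" if "e \<in> G s" for e
      using own that by (auto simp: G_def)
    show "e \<in> C (own e (\<pi> e s)) \<and> own e (\<pi> e s) \<notin> R s" if "e \<in> G s" for e
    proof -
      have e: "e \<in> M" "s \<in> H e" using that by (auto simp: G_def)
      have p: "\<pi> e s \<in> H e" "\<pi> e s \<noteq> s" using \<pi>[OF e] by auto
      have "own e (\<pi> e s) \<in> R (\<pi> e s)" "\<pi> e s \<in> X" using ownR[OF e(1) p(1)] H[OF e(1)] p by auto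
      then show ?thesis using own[OF e(1) p(1)] X(3)[OF _ s p(2)] by auto
    qed
  qed (use sub R s in auto)
  then have "(\<Sum>s\<in>X. 2 * int t * int (card (R s)) - 2 * int (card (R s))) \<le>
      (\<Sum>s\<in>X. 2 * int t * int (card (hits (R s))) + (\<Sum>e\<in>G s. T e s))"
    by (rule sum_mono)
  moreover have "int (card P) = (\<Sum>s\<in>X. int (card (R s)))"
    unfolding X(2) using X fR by (subst card_UN_disjoint) auto
  ultimately have 1: "2 * int t * int (card P) - 2 * int (card P) \<le>
      2 * int t * (\<Sum>s\<in>X. int (card (hits (R s)))) + (\<Sum>s\<in>X. \<Sum>e\<in>G s. T e s)"
    by (simp add: sum.distrib sum_subtractf sum_distrib_left)
  have "(\<Sum>s\<in>X. int (card (hits (R s)))) = (\<Sum>s\<in>X. \<Sum>e\<in>{e \<in> M. e \<in> hits (R s)}. 1)"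
    using M X by (intro sum.cong refl) (auto simp: hits_def intro!: arg_cong[of _ _ card])
  also have "\<dots> = (\<Sum>e\<in>M. \<Sum>s\<in>{s \<in> X. e \<in> hits (R s)}. 1)"
    by (rule sum.swap_restrict[OF X(1) M(1)])
  finally have 2: "(\<Sum>s\<in>X. int (card (hits (R s)))) = (\<Sum>e\<in>M. int (card {s \<in> X. e \<in> hits (R s)}))" by simp
  have "(\<Sum>s\<in>X. \<Sum>e\<in>G s. T e s) = (\<Sum>e\<in>M. \<Sum>s\<in>{s \<in> X. s \<in> H e}. T e s)"
    unfolding G_def by (rule sum.swap_restrict[OF X(1) M(1)])
  also have "\<dots> = (\<Sum>e\<in>M. \<Sum>s\<in>H e. T e s)"
    using H by (intro sum.cong) auto
  also have "\<dots> = (\<Sum>e\<in>M. - int t * int (card (H e)))"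
  proof (rule sum.cong[OF refl])
    fix e assume e: "e \<in> M"
    \<comment> \<open>The involution \<open>\<pi> e\<close> exchanges giver and receiver, so
      incoming and outgoing moves at \<open>e\<close> have the same sum and only the missing halves
      remain.\<close>
    have "(\<Sum>s\<in>H e. int (relief (own e s) (own e (\<pi> e s)))) = (\<Sum>s\<in>H e. int (relief (own e (\<pi> e s)) (own e s)))"
      by (rule sum.reindex_bij_witness[of _ "\<pi> e" "\<pi> e"]) (use \<pi>[OF e] in auto)
    then show "(\<Sum>s\<in>H e. T e s) = - int t * int (card (H e))"
      by (simp add: T_def sum_subtractf)
  qed
  finally have 3: "(\<Sum>s\<in>X. \<Sum>e\<in>G s. T e s) = (\<Sum>e\<in>M. - int t * int (card (H e)))" .
  have "(\<Sum>e\<in>M. 2 * int t * int (card {s \<in> X. e \<in> hits (R s)}) - int t * int (card (H e))) \<le> (\<Sum>e\<in>M. 4 * int t)"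
  proof (rule sum_mono)
    fix e assume "e \<in> M"
    then have "int t * (2 * int (card {s \<in> X. e \<in> hits (R s)})) \<le> int t * (4 + int (card (H e)))"
      using H[of e] by (intro mult_left_mono) linarith+
    then show "2 * int t * int (card {s \<in> X. e \<in> hits (R s)}) - int t * int (card (H e)) \<le> 4 * int t"
      by (simp add: algebra_simps)
  qed
  then have "2 * int t * (\<Sum>s\<in>X. int (card (hits (R s)))) + (\<Sum>s\<in>X. \<Sum>e\<in>G s. T e s) \<le> 4 * int t * int (card M)"
    unfolding 2 3 by (simp add: sum_subtractf sum_distrib_left sum_negf mult_ac)
  with 1 show ?thesis by (simp add: algebra_simps)
qed

end

section \<open>Runs of a consecutive matching\<close>

definition shift :: "nat \<times> nat \<Rightarrow> nat \<times> nat" where "shift f = (Suc (fst f), Suc (snd f))"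

fun run_start :: "(nat \<times> nat) set \<Rightarrow> nat \<times> nat \<Rightarrow> nat \<times> nat" where
  "run_start P (Suc i, Suc j) = (if (i, j) \<in> P then run_start P (i, j) else (Suc i, Suc j))"
| "run_start P f = f"

text \<open>A run is named by its first edge, which makes the runs the fibres of
  \<open>run_start\<close> on \<open>P\<close>.\<close>

definition run :: "(nat \<times> nat) set \<Rightarrow> nat \<times> nat \<Rightarrow> (nat \<times> nat) set" where
  "run P s = {f \<in> P. run_start P f = s}"

lemma run_start_shift: "f \<in> P \<Longrightarrow> run_start P (shift f) = run_start P f"
  by (cases f) (simp add: shift_def)

lemma run_start_eq: "(\<And>g. g \<in> P \<Longrightarrow> shift g \<noteq> f) \<Longrightarrow> run_start P f = f"
proof (induction P f rule: run_start.induct)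
  case (1 P i j)
  have "(i, j) \<notin> P" using 1(2)[of "(i, j)"] by (auto simp: shift_def)
  then show ?case by simp
qed auto

text \<open>This turns a run into an unbroken sequence of shifts of its start; the order of its
  edges and the bound on its length are derived from it.\<close>

lemma run_start_cases:
  "f \<in> P \<Longrightarrow> \<exists>l. f = (shift ^^ l) (run_start P f) \<and> (\<forall>m\<le>l. (shift ^^ m) (run_start P f) \<in> P)"
proof (induction P f rule: run_start.induct)
  case (1 P i j)
  show ?case
  proof (cases "(i, j) \<in> P")
    case True
    then obtain l where l: "(i, j) = (shift ^^ l) (run_start P (i, j))"
      "\<forall>m\<le>l. (shift ^^ m) (run_start P (i, j)) \<in> P" using 1 by auto
    have "(shift ^^ Suc l) (run_start P (i, j)) = shift (i, j)"
      using arg_cong[OF l(1), of shift] by simp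
    then have "(Suc i, Suc j) = (shift ^^ Suc l) (run_start P (i, j))" by (simp add: shift_def)
    moreover have "\<forall>m\<le>Suc l. (shift ^^ m) (run_start P (i, j)) \<in> P"
      using l(2) 1(2) calculation by (metis le_Suc_eq)
    moreover have "run_start P (Suc i, Suc j) = run_start P (i, j)" using True by simp
    ultimately show ?thesis by metis
  qed (use 1 in \<open>auto intro!: exI[of _ 0]\<close>)
qed (auto intro!: exI[of _ 0])

lemma run_start_in: "f \<in> P \<Longrightarrow> run_start P f \<in> P"
  using run_start_cases[of f P] by (metis funpow_0 le0)

lemma run_start_idem: "f \<in> P \<Longrightarrow> run_start P (run_start P f) = run_start P f"
proof (induction P f rule: run_start.induct)
  case (1 P i j)
  then show ?case by auto
qed auto

lemma fst_shift_power: "fst ((shift ^^ l) f) = fst f + l"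
  by (induction l) (auto simp: shift_def)

lemma run_between:
  assumes "f \<in> P" "f' \<in> P" "run_start P f = run_start P f'" "fst f < fst f'"
  shows "shift f \<in> P"
proof -
  obtain l where l: "f = (shift ^^ l) (run_start P f)" using run_start_cases[OF assms(1)] by auto
  obtain l' where l': "f' = (shift ^^ l') (run_start P f)" "\<forall>m\<le>l'. (shift ^^ m) (run_start P f) \<in> P"
    using run_start_cases[OF assms(2)] assms(3) by auto
  have "fst f = fst (run_start P f) + l" "fst f' = fst (run_start P f) + l'"
    using l l'(1) fst_shift_power by metis+
  with assms(4) have "Suc l \<le> l'" by linarith
  then have "(shift ^^ Suc l) (run_start P f) \<in> P" using l'(2) by blast
  then show ?thesis using l by simp
qed

lemma run_same_fst:
  assumes "f \<in> P" "f' \<in> P" "run_start P f = run_start P f'" "fst f = fst f'"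
  shows "f = f'"
proof -
  obtain l where l: "f = (shift ^^ l) (run_start P f)" using run_start_cases[OF assms(1)] by auto
  obtain l' where l': "f' = (shift ^^ l') (run_start P f)"
    using run_start_cases[OF assms(2)] assms(3) by auto
  have "fst f = fst (run_start P f) + l" "fst f' = fst (run_start P f) + l'"
    using l l'(1) fst_shift_power by metis+
  with assms(4) l l' show ?thesis by auto
qed

lemma run_last_unique:
  assumes "f \<in> P" "f' \<in> P" "run_start P f = run_start P f'" "shift f \<notin> P" "shift f' \<notin> P"
  shows "f = f'"
  using run_between[of f P f'] run_between[of f' P f] run_same_fst[of f P f'] assms
  by (metis linorder_neqE_nat)

lemma run_last_exists:
  assumes "finite P" "f \<in> P"
  shows "\<exists>g\<in>P. run_start P g = run_start P f \<and> shift g \<notin> P"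
proof -
  have fin: "finite (run P (run_start P f))" and "f \<in> run P (run_start P f)" using assms by (auto simp: run_def)
  then have "Max (fst ` run P (run_start P f)) \<in> fst ` run P (run_start P f)" by (intro Max_in) auto
  then obtain g where g0: "g \<in> run P (run_start P f)" "fst g = Max (fst ` run P (run_start P f))" by auto
  then have g: "g \<in> run P (run_start P f)" "\<And>g'. g' \<in> run P (run_start P f) \<Longrightarrow> fst g' \<le> fst g"
    using fin by auto
  have "shift g \<notin> P"
  proof
    assume "shift g \<in> P"
    then have "shift g \<in> run P (run_start P f)" using g(1) by (auto simp: run_def run_start_shift)
    from g(2)[OF this] show False by (simp add: shift_def)
  qed
  with g(1) show ?thesis by (auto simp: run_def)
qed

definition run_last :: "(nat \<times> nat) set \<Rightarrow> nat \<times> nat \<Rightarrow> nat \<times> nat" where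
  "run_last P s = (SOME g. g \<in> run P s \<and> shift g \<notin> P)"

lemma run_last:
  assumes "finite P" "f \<in> P"
  shows "run_last P (run_start P f) \<in> run P (run_start P f)" "shift (run_last P (run_start P f)) \<notin> P"
  using someI_ex[of "\<lambda>g. g \<in> run P (run_start P f) \<and> shift g \<notin> P"] run_last_exists[OF assms]
  by (auto simp: run_last_def run_def)

lemma run_last_eq:
  assumes "finite P" "f \<in> P" "shift f \<notin> P"
  shows "f = run_last P (run_start P f)"
  using run_last_unique[of f P "run_last P (run_start P f)"] run_last[OF assms(1,2)] assms by (auto simp: run_def)

section \<open>The runs in conflict with one edge\<close>

definition touches :: "(nat \<times> nat \<Rightarrow> nat) \<Rightarrow> nat \<Rightarrow> nat \<times> nat \<Rightarrow> bool" where
  "touches c x f \<longleftrightarrow> x \<le> c f + 1 \<and> c f \<le> x + 1"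

definition run_end :: "(nat \<times> nat) set \<Rightarrow> nat \<times> nat \<Rightarrow> nat \<times> nat \<Rightarrow> bool" where
  "run_end P s f \<longleftrightarrow> f = s \<or> f = run_last P s"

text \<open>The function \<open>c\<close> is one of the two coordinates. If some edge of
  \<open>P\<close> lies at \<open>x\<close>, then edges at \<open>x - 1\<close> and
  \<open>x + 1\<close> are its neighbours in the same run. Otherwise at most one edge lies at each
  of these two positions. As nothing lies at \<open>x\<close>, the former ends its run and the
  latter starts its run, and if the runs differ, each has no other touching edge.\<close>

lemma touched_runs:
  fixes c :: "nat \<times> nat \<Rightarrow> nat" and x :: nat and s :: "nat \<times> nat"
  assumes P: "finite P" and inj: "inj_on c P"
    and step: "\<And>f g. f \<in> P \<Longrightarrow> g \<in> P \<Longrightarrow> c g = Suc (c f) \<Longrightarrow> g = shift f"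
    and c: "\<And>f. c (shift f) = Suc (c f)"
  defines "T \<equiv> run_start P ` {f \<in> P. touches c x f}"
  shows "card T \<le> 2"
    and "card T = 2 \<Longrightarrow> s \<in> T \<Longrightarrow> \<exists>f\<in>run P s. run_end P s f \<and> (\<forall>g\<in>run P s. touches c x g \<longleftrightarrow> g = f)"
proof -
  define F where "F = {f \<in> P. touches c x f}"
  have "card T \<le> 2 \<and> (card T = 2 \<longrightarrow> s \<in> T \<longrightarrow> (\<exists>f\<in>run P s. run_end P s f \<and> (\<forall>g\<in>run P s. touches c x g \<longleftrightarrow> g = f)))"
  proof (cases "\<exists>f0\<in>P. c f0 = x")
    case True
    then obtain f0 where f0: "f0 \<in> P" "c f0 = x" by auto
    have "run_start P f = run_start P f0" if "f \<in> F" for f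
    proof -
      have f: "f \<in> P" "c f = x \<or> c f = Suc x \<or> Suc (c f) = x" using that by (auto simp: F_def touches_def)
      then consider "f = f0" | "f = shift f0" | "f0 = shift f"
        using f0 step[of f0 f] step[of f f0] inj_onD[OF inj, of f f0] by metis
      then show ?thesis using f f0 by cases (auto simp: run_start_shift)
    qed
    then have "T \<subseteq> {run_start P f0}" by (auto simp: T_def F_def)
    then have "card T \<le> 1" using card_mono[of "{run_start P f0}" T] by simp
    then show ?thesis by simp
  next
    case False
    define A where "A = {f \<in> P. c f = Suc x}"
    define B where "B = {f \<in> P. Suc (c f) = x}"
    have F: "F = A \<union> B" "A \<inter> B = {}"
      using False by (fastforce simp: F_def A_def B_def touches_def)+
    have fin: "finite A" "finite B" "finite F" using P by (auto simp: A_def B_def F_def)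
    have "card A \<le> 1" "card B \<le> 1"
      using inj by (auto simp: A_def B_def inj_on_def card_le_Suc0_iff_eq P)
    then have cF: "card F \<le> 2" using F fin by (simp add: card_Un_disjoint)
    then have cT: "card T \<le> 2" using card_image_le[OF fin(3), of "run_start P"] by (simp add: T_def F_def)
    moreover have "\<exists>f\<in>run P s. run_end P s f \<and> (\<forall>g\<in>run P s. touches c x g \<longleftrightarrow> g = f)" if two: "card T = 2" and s: "s \<in> T"
    proof -
      have injF: "inj_on (run_start P) F"
        using two cF fin card_image_le[OF fin(3), of "run_start P"]
        by (intro eq_card_imp_inj_on) (auto simp: T_def F_def)
      obtain f where f: "f \<in> F" "run_start P f = s" using s by (auto simp: T_def F_def)
      have uniq: "touches c x g \<longleftrightarrow> g = f" if "g \<in> run P s" for g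
        using injF f that by (auto simp: run_def F_def dest: inj_onD)
      have "run_end P s f"
      proof (cases "f \<in> A")
        case True
        have "run_start P f = f"
          using False True c by (intro run_start_eq) (auto simp: A_def)
        then show ?thesis using f by (simp add: run_end_def)
      next
        case notA: False
        then have "f \<in> B" using f F by auto
        then have "shift f \<notin> P" "f \<in> P" using False c[of f] by (auto simp: B_def simp del: split_paired_All)
        then have "f = run_last P s" using run_last_eq[OF P] f(2) by metis
        then show ?thesis by (simp add: run_end_def)
      qed
      moreover have "f \<in> run P s" using f by (simp add: run_def F_def)
      ultimately show ?thesis using uniq by blast
    qed
    ultimately show ?thesis by blast
  qed
  then show "card T \<le> 2"
    "card T = 2 \<Longrightarrow> s \<in> T \<Longrightarrow> \<exists>f\<in>run P s. run_end P s f \<and> (\<forall>g\<in>run P s. touches c x g \<longleftrightarrow> g = f)" by auto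
qed

text \<open>The sets \<open>A\<close> and \<open>B\<close> are the runs touched at the two endpoints
  of an edge. Two runs may get full shares, three need one pair of halves and four need two pairs. A
  pair is always found among the runs touched at only one endpoint: two runs of the same side, or
  one run of each side if the sides share the third one.\<close>

lemma pairing:
  assumes fin: "finite A" "finite B" and card: "card A \<le> 2" "card B \<le> 2"
    and good: "\<And>s. card A = 2 \<Longrightarrow> s \<in> A - B \<Longrightarrow> Q s" "\<And>s. card B = 2 \<Longrightarrow> s \<in> B - A \<Longrightarrow> Q s"
  shows "\<exists>H \<pi>. H \<subseteq> A \<union> B \<and> 2 * card (A \<union> B) \<le> 4 + card H \<and>
    (\<forall>s\<in>H. Q s \<and> \<pi> s \<in> H \<and> \<pi> s \<noteq> s \<and> \<pi> (\<pi> s) = s)"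
proof -
  have tot: "card (A \<union> B) + card (A \<inter> B) = card A + card B"
    using card_Un_Int[OF fin] by simp
  have dA: "card (A - B) + card (A \<inter> B) = card A" and dB: "card (B - A) + card (A \<inter> B) = card B"
    using card_Int_Diff[OF fin(1), of B] card_Int_Diff[OF fin(2), of A] by (auto simp: Int_commute)
  have pair: ?thesis if "s1 \<noteq> s2" "Q s1" "Q s2" "s1 \<in> A \<union> B" "s2 \<in> A \<union> B" "card (A \<union> B) \<le> 3" for s1 s2
    using that by (intro exI[of _ "{s1, s2}"] exI[of _ "\<lambda>s. if s = s1 then s2 else s1"]) auto
  consider "card (A \<union> B) \<le> 2" | "card (A \<union> B) = 3" "card (A - B) = 2" "card A = 2"
    | "card (A \<union> B) = 3" "card (B - A) = 2" "card B = 2"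
    | "card (A \<union> B) = 3" "card (A - B) = 1" "card (B - A) = 1" "card A = 2" "card B = 2"
    | "card (A \<union> B) = 4" "card (A - B) = 2" "card (B - A) = 2" "card A = 2" "card B = 2"
    using tot dA dB card by linarith
  then show ?thesis
  proof cases
    case 1
    then show ?thesis by (intro exI[of _ "{}"]) auto
  next
    case 2
    then obtain s1 s2 where "A - B = {s1, s2}" "s1 \<noteq> s2" by (auto simp: card_2_iff)
    then show ?thesis using good(1)[OF 2(3)] 2 by (intro pair[of s1 s2]) auto
  next
    case 3
    then obtain s1 s2 where "B - A = {s1, s2}" "s1 \<noteq> s2" by (auto simp: card_2_iff)
    then show ?thesis using good(2)[OF 3(3)] 3 by (intro pair[of s1 s2]) auto
  next
    case 4
    then obtain s1 s2 where "A - B = {s1}" "B - A = {s2}" by (auto simp: card_1_singleton_iff)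
    then show ?thesis using good(1)[OF 4(4)] good(2)[OF 4(5)] 4 by (intro pair[of s1 s2]) auto
  next
    case 5
    then obtain s1 s2 s3 s4 where s: "A - B = {s1, s2}" "s1 \<noteq> s2" "B - A = {s3, s4}" "s3 \<noteq> s4"
      by (auto simp: card_2_iff)
    moreover have "A \<inter> B = {}" using tot 5 fin by auto
    ultimately have AB: "A = {s1, s2}" "B = {s3, s4}" "s1 \<noteq> s3" "s1 \<noteq> s4" "s2 \<noteq> s3" "s2 \<noteq> s4" by auto
    show ?thesis
      by (rule exI[of _ "{s1, s2, s3, s4}"],
          rule exI[of _ "\<lambda>s. if s = s1 then s2 else if s = s2 then s1 else if s = s3 then s4 else s3"])
        (use good(1)[OF 5(4)] good(2)[OF 5(5)] 5(1) s AB in auto)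
  qed
qed

text \<open>The conflict used in the charging. Unlike \<open>clash\<close>, which governs the
  deletions in a swap, it includes edges on a common diagonal; this makes it a union of two
  conditions on single coordinates.\<close>

definition near :: "nat \<times> nat \<Rightarrow> nat \<times> nat \<Rightarrow> bool" where
  "near e f \<longleftrightarrow> touches fst (fst e) f \<or> touches snd (snd e) f"

lemma near_refl: "near e e" by (simp add: near_def touches_def)

section \<open>Local optima against an optimum with short runs\<close>

lemma consecutive_matching_subset:
  assumes "consecutive_matching E M" "M' \<subseteq> M"
  shows "consecutive_matching E M'"
  using assms unfolding consecutive_matching_def matching_def consecutive_def by blast

lemma consecutive_matching_inj:
  assumes "consecutive_matching E M"
  shows "inj_on fst M" "inj_on snd M"
proof -
  have "i = i' \<longleftrightarrow> j = j'" if "(i, j) \<in> M" "(i', j') \<in> M" for i j i' j'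
    using assms that unfolding consecutive_matching_def matching_def by blast
  then show "inj_on fst M" "inj_on snd M" by (auto intro!: inj_onI)
qed

lemma consecutive_matching_step:
  assumes "consecutive_matching E M" "f \<in> M" "g \<in> M"
  shows "fst g = Suc (fst f) \<Longrightarrow> g = shift f" "snd g = Suc (snd f) \<Longrightarrow> g = shift f"
proof -
  obtain i j i' j' where fg: "f = (i, j)" "g = (i', j')" by (cases f, cases g)
  have "(i, j) \<in> M" "(i', j') \<in> M" using assms fg by auto
  then have "i' = i + 1 \<Longrightarrow> j' = j + 1" "j' = j + 1 \<Longrightarrow> i' = i + 1"
    using assms(1) unfolding consecutive_matching_def consecutive_def by blast+
  then show "fst g = Suc (fst f) \<Longrightarrow> g = shift f" "snd g = Suc (snd f) \<Longrightarrow> g = shift f"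
    by (auto simp: fg shift_def)
qed

text \<open>There are three positions on each side, with at most one edge of a matching at each.
  Taken at both ends of a run, this gives the 12 in \<open>charging\<close>.\<close>

lemma card_near_le:
  assumes "consecutive_matching E M" "finite M"
  shows "card {e \<in> M. near e f} \<le> 6"
proof -
  have "card {e \<in> M. touches fst (fst e) f} \<le> card {fst f - 1..fst f + 1}"
    by (intro card_inj_on_le[of fst] inj_on_subset[OF consecutive_matching_inj(1)[OF assms(1)]])
      (auto simp: touches_def)
  moreover have "card {e \<in> M. touches snd (snd e) f} \<le> card {snd f - 1..snd f + 1}"
    by (intro card_inj_on_le[of snd] inj_on_subset[OF consecutive_matching_inj(2)[OF assms(1)]])
      (auto simp: touches_def)
  moreover have "{e \<in> M. near e f} = {e \<in> M. touches fst (fst e) f} \<union> {e \<in> M. touches snd (snd e) f}"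
    by (auto simp: near_def)
  moreover have "card ({e \<in> M. touches fst (fst e) f} \<union> {e \<in> M. touches snd (snd e) f}) \<le>
      card {e \<in> M. touches fst (fst e) f} + card {e \<in> M. touches snd (snd e) f}" by (rule card_Un_le)
  ultimately show ?thesis by simp
qed

lemma local_optimum_short_runs:
  assumes E: "finite E" and M: "consecutive_matching E M" and P: "consecutive_matching E P"
    and opt: "\<And>S. consecutive_matching E S \<Longrightarrow> card S \<le> K \<Longrightarrow> card S \<le> card {e \<in> M. \<exists>f\<in>S. near e f}"
    and K: "13 * t \<le> K"
    and short: "\<And>f. f \<in> P \<Longrightarrow> card (run P (run_start P f)) \<le> t"
  shows "(int t - 1) * int (card P) \<le> 2 * int t * int (card M)"
proof -
  have finM: "finite M" and finP: "finite P"
    using E M P finite_subset unfolding consecutive_matching_def matching_def by blast+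
  define C where "C f = {e \<in> M. near e f}" for f
  have UC: "\<Union> (C ` S) = {e \<in> M. \<exists>f\<in>S. near e f}" for S by (auto simp: C_def)
  have so: "swap_optimal C P K t"
  proof
    show "card S \<le> card (\<Union> (C ` S))" if "S \<subseteq> P" "card S \<le> K" for S
      unfolding UC by (rule opt[OF consecutive_matching_subset[OF P that(1)] that(2)])
    show "finite P" "13 * t \<le> K" by fact+
    show "finite (C f)" for f using finM by (simp add: C_def)
  qed
  note hits_def = swap_optimal.hits_def[OF so]
  \<comment> \<open>The condition for halving: the run \<open>s\<close> conflicts with
    \<open>e\<close> through a single edge \<open>f\<close>, and \<open>f\<close> is an end of the
    run. This \<open>f\<close> becomes \<open>own e s\<close>.\<close>
  define Q where "Q e s f \<longleftrightarrow> f \<in> run P s \<and> run_end P s f \<and> (\<forall>g\<in>run P s. near e g \<longleftrightarrow> g = f)" for e s f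
  define good where "good e H \<pi> \<longleftrightarrow> H \<subseteq> run_start P ` P \<and>
      2 * card {s \<in> run_start P ` P. e \<in> swap_optimal.hits C (run P s)} \<le> 4 + card H \<and>
      (\<forall>s\<in>H. (\<exists>f. Q e s f) \<and> \<pi> s \<in> H \<and> \<pi> s \<noteq> s \<and> \<pi> (\<pi> s) = s)" for e H \<pi>
  have ex: "\<exists>H \<pi>. good e H \<pi>" if e: "e \<in> M" for e
  proof -
    define A where "A = run_start P ` {f \<in> P. touches fst (fst e) f}"
    define B where "B = run_start P ` {f \<in> P. touches snd (snd e) f}"
    have N: "{s \<in> run_start P ` P. e \<in> swap_optimal.hits C (run P s)} = A \<union> B"
    proof -
      have "{s \<in> run_start P ` P. e \<in> swap_optimal.hits C (run P s)} = run_start P ` {f \<in> P. near e f}"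
      proof (intro set_eqI iffI)
        fix s assume "s \<in> {s \<in> run_start P ` P. e \<in> swap_optimal.hits C (run P s)}"
        then obtain f where "f \<in> run P s" "e \<in> C f" unfolding hits_def by blast
        then show "s \<in> run_start P ` {f \<in> P. near e f}" unfolding run_def C_def by blast
      next
        fix s assume "s \<in> run_start P ` {f \<in> P. near e f}"
        then obtain f where f: "f \<in> P" "near e f" "s = run_start P f" by blast
        then have "f \<in> run P s" "e \<in> C f" using e by (simp_all add: run_def C_def)
        then show "s \<in> {s \<in> run_start P ` P. e \<in> swap_optimal.hits C (run P s)}"
          unfolding hits_def using f by blast
      qed
      also have "\<dots> = A \<union> B"
        unfolding A_def B_def image_Un[symmetric] by (rule arg_cong[of _ _ "image (run_start P)"]) (auto simp: near_def)
      finally show ?thesis .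
    qed
    have tA: "card A \<le> 2" "\<And>s. card A = 2 \<Longrightarrow> s \<in> A \<Longrightarrow>
        \<exists>f\<in>run P s. run_end P s f \<and> (\<forall>g\<in>run P s. touches fst (fst e) g \<longleftrightarrow> g = f)"
      unfolding A_def
      by (rule touched_runs[OF finP consecutive_matching_inj(1)[OF P]];
          (rule consecutive_matching_step(1)[OF P] | simp add: shift_def); assumption)+
    have tB: "card B \<le> 2" "\<And>s. card B = 2 \<Longrightarrow> s \<in> B \<Longrightarrow>
        \<exists>f\<in>run P s. run_end P s f \<and> (\<forall>g\<in>run P s. touches snd (snd e) g \<longleftrightarrow> g = f)"
      unfolding B_def
      by (rule touched_runs[OF finP consecutive_matching_inj(2)[OF P]];
          (rule consecutive_matching_step(2)[OF P] | simp add: shift_def); assumption)+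
    have "\<exists>H \<pi>. H \<subseteq> A \<union> B \<and> 2 * card (A \<union> B) \<le> 4 + card H \<and>
      (\<forall>s\<in>H. (\<exists>f. Q e s f) \<and> \<pi> s \<in> H \<and> \<pi> s \<noteq> s \<and> \<pi> (\<pi> s) = s)"
    proof (rule pairing[where Q = "\<lambda>s. \<exists>f. Q e s f"])
      show "finite A" "finite B" using finP by (auto simp: A_def B_def)
      show "card A \<le> 2" by (fact tA(1))
      show "card B \<le> 2" by (fact tB(1))
      show "\<exists>f. Q e s f" if two: "card A = 2" and s: "s \<in> A - B" for s
      proof -
        have "\<exists>f\<in>run P s. run_end P s f \<and> (\<forall>g\<in>run P s. touches fst (fst e) g \<longleftrightarrow> g = f)"
          by (rule tA(2)) (use two s in auto)
        \<comment> \<open>A run outside \<open>B\<close> is not touched at the right endpoint, so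
          for its edges \<open>near\<close> reduces to touching at the left endpoint.\<close>
        moreover have "\<not> touches snd (snd e) g" if "g \<in> run P s" for g
          using s that by (auto simp: B_def run_def)
        ultimately show ?thesis unfolding Q_def near_def by blast
      qed
      show "\<exists>f. Q e s f" if two: "card B = 2" and s: "s \<in> B - A" for s
      proof -
        have "\<exists>f\<in>run P s. run_end P s f \<and> (\<forall>g\<in>run P s. touches snd (snd e) g \<longleftrightarrow> g = f)"
          by (rule tB(2)) (use two s in auto)
        moreover have "\<not> touches fst (fst e) g" if "g \<in> run P s" for g
          using s that by (auto simp: A_def run_def)
        ultimately show ?thesis unfolding Q_def near_def by blast
      qed
    qed
    moreover have "A \<union> B \<subseteq> run_start P ` P" by (auto simp: A_def B_def)
    ultimately show ?thesis unfolding good_def N by blast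
  qed
  have "\<forall>e. \<exists>p. e \<in> M \<longrightarrow> good e (fst p) (snd p)" using ex by fastforce
  from choice[OF this] obtain p where p: "\<forall>e. e \<in> M \<longrightarrow> good e (fst (p e)) (snd (p e))" by blast
  define H where "H e = fst (p e)" for e
  define \<pi> where "\<pi> e = snd (p e)" for e
  have H: "H e \<subseteq> run_start P ` P \<and>
      2 * card {s \<in> run_start P ` P. e \<in> swap_optimal.hits C (run P s)} \<le> 4 + card (H e) \<and>
      (\<forall>s\<in>H e. (\<exists>f. Q e s f) \<and> \<pi> e s \<in> H e \<and> \<pi> e s \<noteq> s \<and> \<pi> e (\<pi> e s) = s)" if "e \<in> M" for e
    using p[rule_format, OF that] unfolding good_def H_def \<pi>_def .
  define own where "own e s = (SOME f. Q e s f)" for e s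
  have own: "Q e s (own e s)" if "e \<in> M" "s \<in> H e" for e s
    unfolding own_def by (rule someI_ex) (use H[OF that(1)] that(2) in blast)
  have starts: "s \<in> P \<and> run_start P s = s" if "s \<in> run_start P ` P" for s
    using that by (auto simp: run_start_in run_start_idem)
  show ?thesis
  proof (rule swap_optimal.charging[OF so, where X = "run_start P ` P" and R = "run P" and a = "\<lambda>s. s" and b = "run_last P"
        and H = H and own = own and \<pi> = \<pi>])
    show "finite M" by (fact finM)
    show "C f \<subseteq> M" for f by (auto simp: C_def)
    show "finite (run_start P ` P)" using finP by simp
    show "P = (\<Union>s\<in>run_start P ` P. run P s)" by (auto simp: run_def)
    show "run P s \<inter> run P s' = {}" if "s \<noteq> s'" for s s' using that by (auto simp: run_def)
    fix s assume s: "s \<in> run_start P ` P"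
    note st = starts[OF s]
    have "run P s = {s}" if "s = run_last P s"
    proof -
      have ns: "shift s \<notin> P" using run_last(2)[OF finP, of s] st that by metis
      have "g = s" if "g \<in> run P s" for g
      proof -
        have g: "g \<in> P" "run_start P s = run_start P g" using that st by (auto simp: run_def)
        obtain l where "g = (shift ^^ l) s" using run_start_cases[OF g(1)] g(2) st by auto
        then have "fst s \<le> fst g" by (simp add: fst_shift_power)
        then show ?thesis using run_between[OF _ g] run_same_fst[OF _ g] ns st by (metis le_neq_implies_less)
      qed
      moreover have "s \<in> run P s" using st by (auto simp: run_def)
      ultimately show ?thesis by auto
    qed
    moreover have "card (run P s) \<le> t" using short[of s] st by simp
    moreover have "s \<in> run P s" using st by (simp add: run_def)
    moreover have "run_last P s \<in> run P s" using run_last(1)[OF finP, of s] st by simp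
    ultimately show "card (run P s) \<le> t \<and> s \<in> run P s \<and> run_last P s \<in> run P s \<and> (s = run_last P s \<longrightarrow> run P s = {s})"
      by blast
    have "{e \<in> M. s \<in> H e} \<subseteq> C s \<union> C (run_last P s)"
    proof
      fix e assume "e \<in> {e \<in> M. s \<in> H e}"
      then have e: "e \<in> M" "s \<in> H e" by auto
      have "near e (own e s)" "own e s = s \<or> own e s = run_last P s"
        using own[OF e] unfolding Q_def run_end_def by blast+
      then show "e \<in> C s \<union> C (run_last P s)" using e(1) unfolding C_def by auto
    qed
    then have "card {e \<in> M. s \<in> H e} \<le> card (C s \<union> C (run_last P s))"
      using finM by (intro card_mono) (auto simp: C_def)
    also have "\<dots> \<le> card (C s) + card (C (run_last P s))" by (rule card_Un_le)
    also have "\<dots> \<le> 12" using card_near_le[OF M finM, of s] card_near_le[OF M finM, of "run_last P s"]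
      by (simp add: C_def)
    finally show "card {e \<in> M. s \<in> H e} \<le> 12" .
  next
    fix e assume e: "e \<in> M"
    show "H e \<subseteq> run_start P ` P \<and> 2 * card {s \<in> run_start P ` P. e \<in> swap_optimal.hits C (run P s)} \<le> 4 + card (H e)"
      using H[OF e] by blast
    fix s assume s: "s \<in> H e"
    show "\<pi> e s \<in> H e \<and> \<pi> e s \<noteq> s \<and> \<pi> e (\<pi> e s) = s" using H[OF e] s by blast
    show "own e s \<in> {s, run_last P s} \<and> e \<in> C (own e s) \<and> e \<notin> swap_optimal.hits C (run P s - {own e s})"
      using own[OF e s] e unfolding Q_def run_end_def C_def hits_def by blast
  qed
qed

section \<open>Cutting the optimum into short runs\<close>

text \<open>Since \<open>t\<close> is congruent to -1 modulo \<open>t + 1\<close>, the witness is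
  the residue of \<open>r - a\<close>, written without subtraction.\<close>

lemma ex_residue: "r \<le> t \<Longrightarrow> \<exists>m\<le>t. (a + m) mod Suc t = r" for a r t :: nat
proof (intro exI[of _ "(r + t * a) mod Suc t"] conjI)
  assume "r \<le> t"
  have "(a + (r + t * a) mod Suc t) mod Suc t = (r + Suc t * a) mod Suc t"
    by (simp add: mod_simps algebra_simps)
  also have "\<dots> = r" using \<open>r \<le> t\<close> by (subst mod_mult_self2) simp
  finally show "(a + (r + t * a) mod Suc t) mod Suc t = r" .
qed (simp add: less_Suc_eq_le[symmetric])

text \<open>The smallest of the \<open>t + 1\<close> residue classes of left positions contains at
  most the fraction \<open>1 / (t + 1)\<close> of the optimum, and without it runs have at most
  \<open>t\<close> edges. The factor \<open>t / (t + 1)\<close> from this deletion and the factor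
  \<open>(t - 1) / t\<close> from the charging multiply to \<open>(t - 1) / (t + 1)\<close>.\<close>

lemma local_optimum_bound:
  assumes E: "finite E" and M: "consecutive_matching E M" and OPT: "consecutive_matching E OPT"
    and opt: "\<And>S. consecutive_matching E S \<Longrightarrow> card S \<le> K \<Longrightarrow> card S \<le> card {e \<in> M. \<exists>f\<in>S. near e f}"
    and K: "13 * t \<le> K" and t: "2 \<le> t"
  shows "(int t - 1) * int (card OPT) \<le> 2 * (int t + 1) * int (card M)"
proof -
  have finO: "finite OPT"
    using E OPT finite_subset unfolding consecutive_matching_def matching_def by blast
  define D where "D r = {f \<in> OPT. fst f mod Suc t = r}" for r
  have "card OPT = card (\<Union>r\<le>t. D r)" by (rule arg_cong[of _ _ card]) (auto simp: D_def less_Suc_eq_le[symmetric])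
  also have "\<dots> = (\<Sum>r\<le>t. card (D r))"
    using finO by (intro card_UN_disjoint) (auto simp: D_def)
  finally have sum: "card OPT = (\<Sum>r\<le>t. card (D r))" .
  obtain r where r: "r \<le> t" "Suc t * card (D r) \<le> card OPT"
  proof -
    have "\<exists>r\<le>t. Suc t * card (D r) \<le> card OPT"
    proof (rule ccontr)
      assume "\<not> ?thesis"
      then have "card OPT < Suc t * card (D r)" if "r \<le> t" for r using that by force
      then have "(\<Sum>r\<le>t. card OPT) < (\<Sum>r\<le>t. Suc t * card (D r))" by (intro sum_strict_mono) auto
      then show False using sum by (simp flip: sum_distrib_left del: mult_Suc)
    qed
    with that show thesis by blast
  qed
  define P where "P = OPT - D r"
  have "card P + card (D r) = card OPT"
    unfolding P_def using finO by (subst card_Diff_subset) (auto simp: D_def card_mono)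
  then have "int (card P) + int (card (D r)) = int (card OPT)" by linarith
  moreover have "(1 + int t) * int (card (D r)) \<le> int (card OPT)"
    using r(2) by (metis of_nat_Suc of_nat_le_iff of_nat_mult)
  ultimately have "int t * int (card (D r)) \<le> int (card P)" by (simp add: algebra_simps)
  then have large: "int t * int (card OPT) \<le> (int t + 1) * int (card P)"
    using \<open>int (card P) + int (card (D r)) = int (card OPT)\<close>[symmetric] by (simp add: algebra_simps)
  have "(int t - 1) * int (card P) \<le> 2 * int t * int (card M)"
  proof (rule local_optimum_short_runs[OF E M _ opt K])
    show "consecutive_matching E P" using consecutive_matching_subset[OF OPT] by (auto simp: P_def)
    fix f assume f: "f \<in> P"
    let ?s = "run_start P f"
    have "run P ?s \<subseteq> (\<lambda>l. (shift ^^ l) ?s) ` {..<t}"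
    proof
      fix g assume g: "g \<in> run P ?s"
      then obtain l where l: "g = (shift ^^ l) ?s" "\<forall>m\<le>l. (shift ^^ m) ?s \<in> P"
        using run_start_cases[of g P] by (auto simp: run_def)
      \<comment> \<open>Otherwise the run would occupy \<open>t + 1\<close> successive left
        positions, and one of them has the deleted residue.\<close>
      have "l < t"
      proof (rule ccontr)
        assume "\<not> l < t"
        moreover obtain m where m: "m \<le> t" "(fst ?s + m) mod Suc t = r" using ex_residue[OF r(1)] by blast
        ultimately have "(shift ^^ m) ?s \<in> P" using l(2) by simp
        then show False using m(2) by (simp add: P_def D_def fst_shift_power)
      qed
      then show "g \<in> (\<lambda>l. (shift ^^ l) ?s) ` {..<t}" using l by auto
    qed
    then show "card (run P ?s) \<le> t" using surj_card_le[of "{..<t}" "run P ?s"] by simp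
  qed auto
  then have "(int t + 1) * ((int t - 1) * int (card P)) \<le> (int t + 1) * (2 * int t * int (card M))"
    by (intro mult_left_mono) auto
  moreover have "(int t - 1) * (int t * int (card OPT)) \<le> (int t - 1) * ((int t + 1) * int (card P))"
    using large t by (intro mult_left_mono) auto
  ultimately have "int t * ((int t - 1) * int (card OPT)) \<le> int t * (2 * (int t + 1) * int (card M))"
    by (simp add: algebra_simps)
  then show ?thesis using t by simp
qed

section \<open>Cost-bounded program execution\<close>

text \<open>A total-correctness judgement. The cost is only bounded from above, so that bounds can
  be rounded with \<open>runs_weaken\<close>; a postcondition may itself be a \<open>runs\<close>
  statement, which is how sequences are composed.\<close>

definition runs :: "com \<Rightarrow> state \<Rightarrow> nat \<Rightarrow> (state \<Rightarrow> bool) \<Rightarrow> bool" where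
  "runs c s b Q \<longleftrightarrow> (\<exists>t s'. exec c s t s' \<and> t \<le> b \<and> Q s')"

lemma runs_SKIP: "Q s \<Longrightarrow> runs SKIP s 1 Q"
  unfolding runs_def using exec.Skip by blast

lemma runs_Assign:
  "Q (s(x := (s x)(aval e1 s := aval e2 s))) \<Longrightarrow> runs (Assign x e1 e2) s (1 + acost e1 + acost e2) Q"
  unfolding runs_def using exec.Assign by blast

lemma runs_Seq: "runs c1 s b1 (\<lambda>s1. runs c2 s1 b2 Q) \<Longrightarrow> runs (Seq c1 c2) s (b1 + b2) Q"
  unfolding runs_def using exec.Seq by (meson add_mono)

lemma runs_If:
  assumes "bval b s \<Longrightarrow> runs c1 s k Q" "\<not> bval b s \<Longrightarrow> runs c2 s k Q"
  shows "runs (If b c1 c2) s (1 + bcost b + k) Q"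
  using assms unfolding runs_def by (cases "bval b s") (meson exec.IfTrue exec.IfFalse add_left_mono)+

lemma runs_weaken: "runs c s b Q \<Longrightarrow> b \<le> b' \<Longrightarrow> (\<And>s'. Q s' \<Longrightarrow> Q' s') \<Longrightarrow> runs c s b' Q'"
  unfolding runs_def by (meson order_trans)

fun assigned :: "com \<Rightarrow> vname set" where
  "assigned SKIP = {}"
| "assigned (Assign x e1 e2) = {x}"
| "assigned (Seq c1 c2) = assigned c1 \<union> assigned c2"
| "assigned (If b c1 c2) = assigned c1 \<union> assigned c2"
| "assigned (While b c) = assigned c"

lemma exec_frame: "exec c s t s' \<Longrightarrow> v \<notin> assigned c \<Longrightarrow> s' v = s v"
  by (induction rule: exec.induct) auto

text \<open>Specifications can thus be confined to the array of interest, and the rest of the state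
  is recovered from the syntax.\<close>

lemma runs_frame: "runs c s b Q \<Longrightarrow> runs c s b (\<lambda>s'. Q s' \<and> (\<forall>v. v \<notin> assigned c \<longrightarrow> s' v = s v))"
  unfolding runs_def using exec_frame by blast

text \<open>The counter is raised before the body, which therefore sees the values from 1 to the
  limit, like the positions of the vertices.\<close>

definition FOR :: "vname \<Rightarrow> vname \<Rightarrow> com \<Rightarrow> com" where
  "FOR x y c = Seq (Assign x (N 0) (N 0))
     (While (Less (V x) (V y)) (Seq (Assign x (N 0) (Plus (V x) (N 1))) c))"

lemma assigned_FOR [simp]: "assigned (FOR x y c) = insert x (assigned c)"
  by (auto simp: FOR_def)

text \<open>\<open>Inv i\<close> holds after \<open>i\<close> passes. It must be insensitive to the
  counter, since the increment comes between one pass and the body of the next. The 6 pays for the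
  last test, the 12 for the test and the increment of a pass.\<close>

lemma runs_While_counter:
  assumes xy: "x \<noteq> y" "x \<notin> assigned c" "y \<notin> assigned c"
    and insensitive: "\<And>i s' f. Inv i s' \<Longrightarrow> Inv i (s'(x := f))"
    and step: "\<And>i s'. i < n \<Longrightarrow> Inv i s' \<Longrightarrow> s' x 0 = Suc i \<Longrightarrow>
      \<forall>v. v \<notin> insert x (assigned c) \<longrightarrow> s' v = s v \<Longrightarrow> runs c s' b (Inv (Suc i))"
    and n: "s y 0 = n"
  shows "i \<le> n \<Longrightarrow> Inv i s' \<Longrightarrow> s' x 0 = i \<Longrightarrow> \<forall>v. v \<notin> insert x (assigned c) \<longrightarrow> s' v = s v \<Longrightarrow>
    runs (While (Less (V x) (V y)) (Seq (Assign x (N 0) (Plus (V x) (N 1))) c)) s' (6 + (n - i) * (12 + b))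
      (\<lambda>s''. Inv n s'' \<and> (\<forall>v. v \<notin> insert x (assigned c) \<longrightarrow> s'' v = s v))"
proof (induction "n - i" arbitrary: i s')
  case 0
  then have "i = n" "s' y 0 = n" using xy n by auto
  then have "\<not> bval (Less (V x) (V y)) s'" using 0 by simp
  from exec.WhileFalse[OF this] show ?case
    using 0 \<open>i = n\<close> unfolding runs_def by (fastforce intro!: exI)
next
  case (Suc k)
  let ?s1 = "s'(x := (s' x)(0 := Suc i))"
  have i: "i < n" and y: "s' y 0 = n" using Suc xy n by auto
  have "runs c ?s1 b (Inv (Suc i))"
    by (rule step[OF i insensitive[OF Suc.prems(2)]]) (use Suc.prems in auto)
  from runs_frame[OF this] obtain t1 s2 where s2: "exec c ?s1 t1 s2" "t1 \<le> b" "Inv (Suc i) s2"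
    "\<forall>v. v \<notin> assigned c \<longrightarrow> s2 v = ?s1 v" unfolding runs_def by blast
  have "runs (While (Less (V x) (V y)) (Seq (Assign x (N 0) (Plus (V x) (N 1))) c)) s2 (6 + (n - Suc i) * (12 + b))
      (\<lambda>s''. Inv n s'' \<and> (\<forall>v. v \<notin> insert x (assigned c) \<longrightarrow> s'' v = s v))"
    by (rule Suc.hyps(1)) (use Suc i s2 xy in auto)
  then obtain t2 s3 where s3: "exec (While (Less (V x) (V y)) (Seq (Assign x (N 0) (Plus (V x) (N 1))) c)) s2 t2 s3"
    "t2 \<le> 6 + (n - Suc i) * (12 + b)" "Inv n s3" "\<forall>v. v \<notin> insert x (assigned c) \<longrightarrow> s3 v = s v"
    unfolding runs_def by blast
  have "exec (Assign x (N 0) (Plus (V x) (N 1))) s' 6 ?s1"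
    using exec.Assign[of x "N 0" "Plus (V x) (N 1)" s'] Suc.prems by (simp add: eval_nat_numeral)
  from exec.Seq[OF this s2(1)]
  have "exec (Seq (Assign x (N 0) (Plus (V x) (N 1))) c) s' (6 + t1) s2" .
  from exec.WhileTrue[OF _ this s3(1)]
  have "exec (While (Less (V x) (V y)) (Seq (Assign x (N 0) (Plus (V x) (N 1))) c)) s' (12 + t1 + t2) s3"
    using Suc.prems i y by simp
  moreover have "12 + t1 + t2 \<le> 6 + (n - i) * (12 + b)"
  proof -
    have "n - i = Suc (n - Suc i)" using i by simp
    then show ?thesis using s2(2) s3(2) by simp
  qed
  ultimately show ?case using s3 unfolding runs_def by blast
qed

lemma runs_FOR:
  assumes xy: "x \<noteq> y" "x \<notin> assigned c" "y \<notin> assigned c"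
    and insensitive: "\<And>i s' f. Inv i s' \<Longrightarrow> Inv i (s'(x := f))"
    and init: "Inv 0 s"
    and step: "\<And>i s'. i < n \<Longrightarrow> Inv i s' \<Longrightarrow> s' x 0 = Suc i \<Longrightarrow>
      \<forall>v. v \<notin> insert x (assigned c) \<longrightarrow> s' v = s v \<Longrightarrow> runs c s' b (Inv (Suc i))"
    and n: "s y 0 = n"
  shows "runs (FOR x y c) s (9 + n * (12 + b)) (\<lambda>s'. Inv n s' \<and> (\<forall>v. v \<notin> insert x (assigned c) \<longrightarrow> s' v = s v))"
proof -
  let ?Q = "\<lambda>s'. Inv n s' \<and> (\<forall>v. v \<notin> insert x (assigned c) \<longrightarrow> s' v = s v)"
  have "runs (FOR x y c) s ((1 + acost (N 0) + acost (N 0)) + (6 + (n - 0) * (12 + b))) ?Q"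
    unfolding FOR_def
  proof (intro runs_Seq runs_Assign, rule runs_While_counter[where Inv = Inv and n = n and s = s, OF xy insensitive step n])
    show "Inv 0 (s(x := (s x)(aval (N 0) s := aval (N 0) s)))" by (rule insensitive[OF init])
  qed auto
  then show ?thesis by (rule runs_weaken) auto
qed

section \<open>Matchings as arrays of partners\<close>

text \<open>A matching is stored as the partners of the left vertices, and 0, which is no position,
  marks an unmatched vertex. Copying, counting and forcing an edge then take linear time, whereas an
  adjacency matrix would take quadratic time.\<close>

definition graph_of :: "nat \<Rightarrow> (nat \<Rightarrow> nat) \<Rightarrow> (nat \<times> nat) set" where
  "graph_of n a = {(x, a x) |x. x \<in> {1..n} \<and> a x \<noteq> 0}"

lemma graph_of_cong: "(\<And>x. x \<in> {1..n} \<Longrightarrow> a x = b x) \<Longrightarrow> graph_of n a = graph_of n b"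
  by (auto simp: graph_of_def)

lemma finite_graph_of: "finite (graph_of n a)"
  by (rule finite_surj[of "{1..n}" _ "\<lambda>x. (x, a x)"]) (auto simp: graph_of_def)

lemma card_graph_of_Suc: "card (graph_of (Suc n) a) = card (graph_of n a) + (if a (Suc n) = 0 then 0 else 1)"
proof (cases "a (Suc n) = 0")
  case True
  then have "graph_of (Suc n) a = graph_of n a" by (auto simp: graph_of_def le_Suc_eq)
  with True show ?thesis by simp
next
  case False
  then have "graph_of (Suc n) a = insert (Suc n, a (Suc n)) (graph_of n a)" by (auto simp: graph_of_def le_Suc_eq)
  moreover have "(Suc n, a (Suc n)) \<notin> graph_of n a" by (auto simp: graph_of_def)
  ultimately show ?thesis using False finite_graph_of by simp
qed

definition copy :: "vname \<Rightarrow> vname \<Rightarrow> com" where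
  "copy a b = FOR ''x'' ''n'' (Assign b (V ''x'') (Arr a (V ''x'')))"

lemma runs_copy:
  assumes "a \<noteq> b" "a \<noteq> ''x''" "b \<noteq> ''x''" "b \<noteq> ''n''" "s ''n'' 0 = n"
  shows "runs (copy a b) s (9 + n * 18) (\<lambda>s'. graph_of n (s' b) = graph_of n (s a))"
proof -
  define Inv where "Inv i s' \<longleftrightarrow> (\<forall>x\<in>{1..i}. s' b x = s a x)" for i and s' :: state
  have "runs (copy a b) s (9 + n * (12 + 6)) (\<lambda>s'. Inv n s' \<and> (\<forall>v. v \<notin> insert ''x'' (assigned (Assign b (V ''x'') (Arr a (V ''x'')))) \<longrightarrow> s' v = s v))"
    unfolding copy_def
  proof (rule runs_FOR)
    fix i s' assume A: "i < n" "Inv i s'" "s' ''x'' 0 = Suc i"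
      "\<forall>v. v \<notin> insert ''x'' (assigned (Assign b (V ''x'') (Arr a (V ''x'')))) \<longrightarrow> s' v = s v"
    have "runs (Assign b (V ''x'') (Arr a (V ''x''))) s' (1 + acost (V ''x'') + acost (Arr a (V ''x''))) (Inv (Suc i))"
      by (rule runs_Assign) (use A assms in \<open>auto simp: Inv_def le_Suc_eq\<close>)
    then show "runs (Assign b (V ''x'') (Arr a (V ''x''))) s' 6 (Inv (Suc i))"
      by (rule runs_weaken) auto
  qed (use assms in \<open>auto simp: Inv_def\<close>)
  then show ?thesis by (rule runs_weaken) (auto simp: Inv_def intro!: graph_of_cong)
qed

definition count :: "vname \<Rightarrow> vname \<Rightarrow> com" where
  "count a c = Seq (Assign c (N 0) (N 0)) (FOR ''x'' ''n''
     (If (Less (N 0) (Arr a (V ''x''))) (Assign c (N 0) (Plus (V c) (N 1))) SKIP))"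

lemma runs_count:
  assumes "a \<noteq> c" "a \<noteq> ''x''" "c \<noteq> ''x''" "c \<noteq> ''n''" "s ''n'' 0 = n"
  shows "runs (count a c) s (12 + n * 24) (\<lambda>s'. s' c 0 = card (graph_of n (s a)))"
proof -
  define Inv where "Inv i s' \<longleftrightarrow> s' c 0 = card (graph_of i (s a))" for i and s' :: state
  let ?c = "If (Less (N 0) (Arr a (V ''x''))) (Assign c (N 0) (Plus (V c) (N 1))) SKIP"
  let ?s = "s(c := (s c)(aval (N 0) s := aval (N 0) s))"
  have *: "runs (FOR ''x'' ''n'' ?c) ?s (9 + n * (12 + 12)) (\<lambda>s'. Inv n s' \<and> (\<forall>v. v \<notin> insert ''x'' (assigned ?c) \<longrightarrow> s' v = ?s v))"
  proof (rule runs_FOR)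
    fix i s' assume A: "i < n" "Inv i s'" "s' ''x'' 0 = Suc i" "\<forall>v. v \<notin> insert ''x'' (assigned ?c) \<longrightarrow> s' v = ?s v"
    have sa: "s' a = s a" using A(4) assms by auto
    have "runs ?c s' (1 + bcost (Less (N 0) (Arr a (V ''x''))) + 6) (Inv (Suc i))"
    proof (rule runs_If)
      assume "bval (Less (N 0) (Arr a (V ''x''))) s'"
      then have "Inv (Suc i) (s'(c := (s' c)(aval (N 0) s' := aval (Plus (V c) (N 1)) s')))"
        using A assms sa by (simp add: Inv_def card_graph_of_Suc)
      from runs_Assign[of "Inv (Suc i)", OF this] show "runs (Assign c (N 0) (Plus (V c) (N 1))) s' 6 (Inv (Suc i))"
        by (rule runs_weaken) auto
    next
      assume "\<not> bval (Less (N 0) (Arr a (V ''x''))) s'"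
      then have "Inv (Suc i) s'" using A sa by (simp add: Inv_def card_graph_of_Suc)
      from runs_SKIP[of "Inv (Suc i)", OF this] show "runs SKIP s' 6 (Inv (Suc i))"
        by (rule runs_weaken) auto
    qed
    then show "runs ?c s' 12 (Inv (Suc i))" by (rule runs_weaken) auto
  qed (use assms in \<open>auto simp: Inv_def graph_of_def\<close>)
  have "runs (count a c) s ((1 + acost (N 0) + acost (N 0)) + (9 + n * (12 + 12)))
      (\<lambda>s'. Inv n s' \<and> (\<forall>v. v \<notin> insert ''x'' (assigned ?c) \<longrightarrow> s' v = ?s v))"
    unfolding count_def by (intro runs_Seq runs_Assign *)
  then show ?thesis by (rule runs_weaken) (auto simp: Inv_def)
qed

section \<open>The local search program\<close>

text \<open>Equality of the differences \<open>fst - snd\<close>, rearranged to avoid truncated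
  subtraction.\<close>

definition diagonal :: "nat \<times> nat \<Rightarrow> nat \<times> nat \<Rightarrow> bool" where
  "diagonal e f \<longleftrightarrow> fst e + snd f = snd e + fst f"

definition clash :: "nat \<times> nat \<Rightarrow> nat \<times> nat \<Rightarrow> bool" where
  "clash e f \<longleftrightarrow> near e f \<and> \<not> diagonal e f"

definition force_edge :: "nat \<times> nat \<Rightarrow> (nat \<times> nat) set \<Rightarrow> (nat \<times> nat) set" where
  "force_edge f X = insert f {e \<in> X. \<not> clash e f}"

text \<open>Edges at distance at most one in a coordinate are compatible exactly if they lie on a
  common diagonal: distance zero gives the matching condition, distance one the consecutive
  condition. So feasibility is a pairwise matter, and inserting an edge only requires deleting those
  that clash with it.\<close>

lemma consecutive_matching_iff:
  "consecutive_matching E M \<longleftrightarrow> M \<subseteq> E \<and> (\<forall>e\<in>M. \<forall>f\<in>M. \<not> clash e f)"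
proof
  assume M: "consecutive_matching E M"
  have "\<not> clash e f" if ef: "e \<in> M" "f \<in> M" for e f
  proof
    assume c: "clash e f"
    then have "fst e = fst f \<or> fst f = Suc (fst e) \<or> fst e = Suc (fst f) \<or>
        snd e = snd f \<or> snd f = Suc (snd e) \<or> snd e = Suc (snd f)"
      unfolding clash_def near_def touches_def by linarith
    then have "f = shift e \<or> e = shift f \<or> e = f"
      using consecutive_matching_step[OF M ef] consecutive_matching_step[OF M ef(2,1)]
        inj_onD[OF consecutive_matching_inj(1)[OF M] _ ef] inj_onD[OF consecutive_matching_inj(2)[OF M] _ ef]
      by blast
    then show False using c by (auto simp: clash_def diagonal_def shift_def)
  qed
  with M show "M \<subseteq> E \<and> (\<forall>e\<in>M. \<forall>f\<in>M. \<not> clash e f)"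
    by (auto simp: consecutive_matching_def matching_def)
next
  assume M: "M \<subseteq> E \<and> (\<forall>e\<in>M. \<forall>f\<in>M. \<not> clash e f)"
  then have *: "\<not> clash (i, j) (i', j')" if "(i, j) \<in> M" "(i', j') \<in> M" for i j i' j' using that by blast
  have "(i = i' \<longleftrightarrow> j = j') \<and> (i' = i + 1 \<longleftrightarrow> j' = j + 1)" if "(i, j) \<in> M" "(i', j') \<in> M" for i j i' j'
    using *[OF that] by (auto simp: clash_def near_def touches_def diagonal_def)
  then show "consecutive_matching E M"
    using M unfolding consecutive_matching_def matching_def consecutive_def by blast
qed

lemma clash_sym: "clash e f \<longleftrightarrow> clash f e"
  by (auto simp: clash_def near_def touches_def diagonal_def)

lemma not_clash_refl: "\<not> clash e e" by (simp add: clash_def diagonal_def add.commute)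

lemma consecutive_matching_force_edge:
  "consecutive_matching E X \<Longrightarrow> f \<in> E \<Longrightarrow> consecutive_matching E (force_edge f X)"
  unfolding consecutive_matching_iff force_edge_def using clash_sym not_clash_refl by blast

text \<open>Edges may be forced repeatedly, so swaps with fewer than \<open>r\<close> edges are
  included. An edge may also evict one that was forced before, but the result remains
  feasible.\<close>

primrec candidates :: "(nat \<times> nat) set \<Rightarrow> nat \<Rightarrow> (nat \<times> nat) set \<Rightarrow> (nat \<times> nat) set set" where
  "candidates E 0 X = {X}"
| "candidates E (Suc r) X = (\<Union>f\<in>E. candidates E r (force_edge f X))"

lemma candidates_consecutive:
  "consecutive_matching E X \<Longrightarrow> Y \<in> candidates E r X \<Longrightarrow> consecutive_matching E Y"
  by (induction r arbitrary: X) (auto dest: consecutive_matching_force_edge)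

text \<open>Compatible edges do not evict each other. In the induction every forced edge joins the
  set \<open>Z\<close> of edges known to survive.\<close>

lemma candidates_superset:
  assumes "set fs \<subseteq> E" "Z \<subseteq> X" "\<And>e f. e \<in> Z \<union> set fs \<Longrightarrow> f \<in> set fs \<Longrightarrow> \<not> clash e f"
  shows "\<exists>Y\<in>candidates E (length fs) X. Z \<union> set fs \<subseteq> Y"
  using assms
proof (induction fs arbitrary: X Z)
  case (Cons f fs)
  have "\<exists>Y\<in>candidates E (length fs) (force_edge f X). insert f Z \<union> set fs \<subseteq> Y"
  proof (rule Cons.IH)
    show "set fs \<subseteq> E" using Cons.prems(1) by simp
    show "insert f Z \<subseteq> force_edge f X"
      using Cons.prems(2) Cons.prems(3)[OF _ list.set_intros(1)] unfolding force_edge_def by blast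
    show "\<not> clash e g" if "e \<in> insert f Z \<union> set fs" "g \<in> set fs" for e g
      using that by (intro Cons.prems(3)) auto
  qed
  then show ?case using Cons.prems by auto
qed auto

text \<open>Forcing the edges of \<open>S\<close> keeps at least the edges of \<open>M\<close> that
  are not near \<open>S\<close>. Some candidate therefore has at least
  \<open>card M - card N + card S\<close> edges, where \<open>N\<close> is the set of edges near
  \<open>S\<close>, and by assumption this is no more than \<open>card M\<close>.\<close>

lemma candidates_local_optimum:
  assumes E: "finite E" and M: "consecutive_matching E M"
    and best: "\<And>Y. Y \<in> candidates E K M \<Longrightarrow> card Y \<le> card M"
    and S: "consecutive_matching E S" "card S \<le> K"
  shows "card S \<le> card {e \<in> M. \<exists>f\<in>S. near e f}"
proof (cases "S = {}")
  case False
  have SE: "S \<subseteq> E" and ME: "M \<subseteq> E" using S M unfolding consecutive_matching_iff by blast+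
  then have fin: "finite S" "finite M" using finite_subset[OF _ E] by blast+
  obtain xs where xs: "set xs = S" "distinct xs" using finite_distinct_list[OF fin(1)] by blast
  obtain f0 where f0: "f0 \<in> S" using False by blast
  \<comment> \<open>Candidates force exactly \<open>K\<close> edges, so the list is padded with a
    repeated edge of \<open>S\<close>, which clashes with nothing in \<open>S\<close>.\<close>
  define fs where "fs = xs @ replicate (K - card S) f0"
  have fs: "set fs = S" "length fs = K"
    using xs f0 S(2) distinct_card[OF xs(2)] by (auto simp: fs_def)
  define N where "N = {e \<in> M. \<exists>f\<in>S. near e f}"
  have "\<exists>Y\<in>candidates E (length fs) M. (M - N) \<union> set fs \<subseteq> Y"
    by (rule candidates_superset)
      (use fs SE S(1) in \<open>auto simp: N_def clash_def consecutive_matching_iff\<close>)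
  then obtain Y where Y: "Y \<in> candidates E K M" "(M - N) \<union> S \<subseteq> Y" using fs by auto
  have "finite Y" using candidates_consecutive[OF M Y(1)] E finite_subset by (auto simp: consecutive_matching_iff)
  then have "card ((M - N) \<union> S) \<le> card Y" using Y by (intro card_mono)
  then have "card ((M - N) \<union> S) \<le> card M" using best[OF Y(1)] by simp
  moreover have "card ((M - N) \<union> S) = card (M - N) + card S"
    using fin near_refl by (intro card_Un_disjoint) (auto simp: N_def)
  moreover have "card M = card (M - N) + card N"
    using fin by (subst card_Diff_subset) (auto simp: N_def card_mono)
  ultimately show ?thesis by (simp add: N_def)
qed simp

section \<open>The program that forces one edge\<close>

abbreviation Le :: "aexp \<Rightarrow> aexp \<Rightarrow> bexp" where "Le a b \<equiv> Not (Less b a)"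

text \<open>The first conjunct is the disjunction in \<open>near\<close> by De Morgan's law; the
  second negates the equation in \<open>diagonal\<close>, given as two inequalities.\<close>

definition clash_test :: "aexp \<Rightarrow> aexp \<Rightarrow> aexp \<Rightarrow> aexp \<Rightarrow> bexp" where
  "clash_test x y i j = And
     (Not (And (Not (And (Le x (Plus i (N 1))) (Le i (Plus x (N 1)))))
               (Not (And (Le y (Plus j (N 1))) (Le j (Plus y (N 1)))))))
     (Not (And (Le (Plus x j) (Plus y i)) (Le (Plus y i) (Plus x j))))"

lemma bval_clash_test:
  "bval (clash_test x y i j) s \<longleftrightarrow> clash (aval x s, aval y s) (aval i s, aval j s)"
  by (auto simp: clash_test_def clash_def near_def touches_def diagonal_def)

text \<open>The nesting depth of the search depends on \<open>K\<close>, and each level needs an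
  array and a counter of its own; the underscores number them.\<close>

definition name :: "char \<Rightarrow> nat \<Rightarrow> vname" where "name c r = c # replicate r (CHR ''_'')"

lemma name_eq_iff [simp]: "name c r = name c' r' \<longleftrightarrow> c = c' \<and> r = r'"
  by (auto simp: name_def dest: arg_cong[of _ _ length])

abbreviation trial :: "nat \<Rightarrow> vname" where "trial \<equiv> name CHR ''T''"
abbreviation index :: "nat \<Rightarrow> vname" where "index \<equiv> name CHR ''k''"

definition force_edge_com :: "vname \<Rightarrow> vname \<Rightarrow> vname \<Rightarrow> com" where
  "force_edge_com k a b = Seq (FOR ''x'' ''n''
     (If (clash_test (V ''x'') (Arr a (V ''x'')) (Arr ''I'' (V k)) (Arr ''J'' (V k)))
        (Assign b (V ''x'') (N 0)) (Assign b (V ''x'') (Arr a (V ''x'')))))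
     (Assign b (Arr ''I'' (V k)) (Arr ''J'' (V k)))"

lemma assigned_force_edge_com [simp]: "assigned (force_edge_com k a b) = {''x'', b}"
  by (auto simp: force_edge_com_def)

text \<open>Overwriting the entry at \<open>i\<close> is harmless, because an old partner of
  \<open>i\<close> either clashes with the new edge or equals \<open>j\<close>. At an unmatched
  vertex the outcome of the test does not matter, as 0 is stored either way.\<close>

lemma graph_of_force_edge:
  assumes "i \<in> {1..n}" "j \<in> {1..n}"
    and b: "\<And>x. x \<in> {1..n} \<Longrightarrow> b x = (if clash (x, a x) (i, j) then 0 else a x)"
  shows "graph_of n (b(i := j)) = force_edge (i, j) (graph_of n a)"
proof -
  have same: "clash (i, a i) (i, j) \<or> a i = j" by (simp add: clash_def near_def touches_def diagonal_def)
  have "(x, y) \<in> graph_of n (b(i := j)) \<longleftrightarrow> (x, y) \<in> force_edge (i, j) (graph_of n a)" for x y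
  proof (cases "x = i")
    case True
    then show ?thesis using assms(1,2) same by (auto simp: graph_of_def force_edge_def)
  next
    case False
    then show ?thesis using b[of x]
      by (cases "clash (x, a x) (i, j)") (auto simp: graph_of_def force_edge_def)
  qed
  then show ?thesis by auto
qed

lemma runs_force_edge_com:
  assumes names: "a \<noteq> b" "k \<noteq> b" "a \<noteq> ''x''" "k \<noteq> ''x''" "b \<notin> {''x'', ''n'', ''I'', ''J''}"
    and s: "s ''n'' 0 = n" "s ''I'' (s k 0) \<in> {1..n}" "s ''J'' (s k 0) \<in> {1..n}"
  shows "runs (force_edge_com k a b) s (100 * n + 100) (\<lambda>s'. graph_of n (s' b) =
    force_edge (s ''I'' (s k 0), s ''J'' (s k 0)) (graph_of n (s a)))"
proof -
  let ?i = "s ''I'' (s k 0)" and ?j = "s ''J'' (s k 0)"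
  let ?t = "clash_test (V ''x'') (Arr a (V ''x'')) (Arr ''I'' (V k)) (Arr ''J'' (V k))"
  let ?c = "If ?t (Assign b (V ''x'') (N 0)) (Assign b (V ''x'') (Arr a (V ''x'')))"
  define Inv where "Inv m s' \<longleftrightarrow> (\<forall>x\<in>{1..m}. s' b x = (if clash (x, s a x) (?i, ?j) then 0 else s a x))"
    for m and s' :: state
  have "runs (FOR ''x'' ''n'' ?c) s (9 + n * (12 + 88)) (\<lambda>s'. Inv n s' \<and> (\<forall>v. v \<notin> insert ''x'' (assigned ?c) \<longrightarrow> s' v = s v))"
  proof (rule runs_FOR)
    fix m s' assume A: "m < n" "Inv m s'" "s' ''x'' 0 = Suc m" "\<forall>v. v \<notin> insert ''x'' (assigned ?c) \<longrightarrow> s' v = s v"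
    have same: "s' a = s a" "s' k = s k" "s' ''I'' = s ''I''" "s' ''J'' = s ''J''" using A(4) names by auto
    have test: "bval ?t s' \<longleftrightarrow> clash (Suc m, s a (Suc m)) (?i, ?j)"
      using A(3) same by (simp add: bval_clash_test)
    have "runs ?c s' (1 + bcost ?t + 6) (Inv (Suc m))"
    proof (rule runs_If)
      assume "bval ?t s'"
      then have "Inv (Suc m) (s'(b := (s' b)(aval (V ''x'') s' := aval (N 0) s')))"
        using A test by (auto simp: Inv_def le_Suc_eq)
      from runs_Assign[of "Inv (Suc m)", OF this] show "runs (Assign b (V ''x'') (N 0)) s' 6 (Inv (Suc m))"
        by (rule runs_weaken) auto
    next
      assume "\<not> bval ?t s'"
      then have "Inv (Suc m) (s'(b := (s' b)(aval (V ''x'') s' := aval (Arr a (V ''x'')) s')))"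
        using A test same by (auto simp: Inv_def le_Suc_eq)
      from runs_Assign[of "Inv (Suc m)", OF this] show "runs (Assign b (V ''x'') (Arr a (V ''x''))) s' 6 (Inv (Suc m))"
        by (rule runs_weaken) auto
    qed
    then show "runs ?c s' 88 (Inv (Suc m))" by (rule runs_weaken) (auto simp: clash_test_def)
  qed (use names s in \<open>auto simp: Inv_def\<close>)
  then have "runs (force_edge_com k a b) s ((9 + n * (12 + 88)) + (1 + acost (Arr ''I'' (V k)) + acost (Arr ''J'' (V k))))
     (\<lambda>s'. graph_of n (s' b) = force_edge (?i, ?j) (graph_of n (s a)))"
    unfolding force_edge_com_def
  proof (intro runs_Seq, elim runs_weaken[OF _ order_refl], intro runs_Assign)
    fix s' assume A: "Inv n s' \<and> (\<forall>v. v \<notin> insert ''x'' (assigned ?c) \<longrightarrow> s' v = s v)"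
    then have same: "s' k = s k" "s' ''I'' = s ''I''" "s' ''J'' = s ''J''" using names by auto
    have "graph_of n ((s' b)(?i := ?j)) = force_edge (?i, ?j) (graph_of n (s a))"
      using A s by (intro graph_of_force_edge) (auto simp: Inv_def)
    then show "graph_of n ((s'(b := (s' b)(aval (Arr ''I'' (V k)) s' := aval (Arr ''J'' (V k)) s'))) b) =
        force_edge (?i, ?j) (graph_of n (s a))"
      using same by simp
  qed
  then show ?thesis by (rule runs_weaken) auto
qed

section \<open>Exhaustive search for the best candidate\<close>

text \<open>The strict inequality records that a replaced solution has become larger, which limits
  the number of rounds.\<close>

definition best_of :: "'a set \<Rightarrow> 'a set set \<Rightarrow> 'a set \<Rightarrow> bool" where
  "best_of X Y Z \<longleftrightarrow> (Z = X \<or> Z \<in> Y \<and> card X < card Z) \<and> (\<forall>W\<in>Y. card W \<le> card Z)"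

lemma best_of_empty: "best_of X {} X" by (simp add: best_of_def)

lemma best_of_trans: "best_of X Y Z \<Longrightarrow> best_of Z Y' Z' \<Longrightarrow> best_of X (Y \<union> Y') Z'"
  by (auto simp: best_of_def)

definition update :: com where
  "update = Seq (count (trial 0) ''a'') (Seq (count ''B'' ''b'')
     (If (Less (V ''b'') (V ''a'')) (copy (trial 0) ''B'') SKIP))"

lemma assigned_copy [simp]: "assigned (copy a b) = {''x'', b}" by (auto simp: copy_def)
lemma assigned_count [simp]: "assigned (count a c) = {''x'', c}" by (auto simp: count_def)
lemma assigned_update [simp]: "assigned update = {''x'', ''a'', ''b'', ''B''}" by (auto simp: update_def)

lemma name_eq_literal [simp]:
  "name c r = c' # cs \<longleftrightarrow> c' = c \<and> cs = replicate r CHR ''_''"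
  "c' # cs = name c r \<longleftrightarrow> c' = c \<and> cs = replicate r CHR ''_''"
  by (auto simp: name_def)

lemma runs_update:
  assumes n: "s ''n'' 0 = n"
  shows "runs update s (66 * n + 39) (\<lambda>s'. best_of (graph_of n (s ''B'')) {graph_of n (s (trial 0))} (graph_of n (s' ''B'')))"
proof -
  let ?X = "graph_of n (s (trial 0))" and ?B = "graph_of n (s ''B'')"
  let ?Q = "\<lambda>s'. best_of ?B {?X} (graph_of n (s' ''B''))"
  have 1: "runs (count (trial 0) ''a'') s (12 + n * 24) (\<lambda>s'. s' ''a'' 0 = card ?X \<and> (\<forall>v. v \<notin> {''x'', ''a''} \<longrightarrow> s' v = s v))"
    using runs_frame[OF runs_count[of "trial 0" "''a''" s n]] n by simp
  have 2: "runs (count ''B'' ''b'') s1 (12 + n * 24) (\<lambda>s'. s' ''b'' 0 = card ?B \<and> s' ''a'' 0 = card ?X \<and> s' ''n'' 0 = n \<and>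
        s' ''B'' = s ''B'' \<and> s' (trial 0) = s (trial 0))"
    if s1: "s1 ''a'' 0 = card ?X \<and> (\<forall>v. v \<notin> {''x'', ''a''} \<longrightarrow> s1 v = s v)" for s1
  proof -
    have "runs (count ''B'' ''b'') s1 (12 + n * 24) (\<lambda>s'. s' ''b'' 0 = card (graph_of n (s1 ''B'')) \<and> (\<forall>v. v \<notin> {''x'', ''b''} \<longrightarrow> s' v = s1 v))"
      using runs_frame[OF runs_count[of "''B''" "''b''" s1 n]] n s1 by simp
    then show ?thesis by (rule runs_weaken) (use s1 n in auto)
  qed
  have 3: "runs (If (Less (V ''b'') (V ''a'')) (copy (trial 0) ''B'') SKIP) s2 (1 + bcost (Less (V ''b'') (V ''a'')) + (9 + n * 18)) ?Q"
    if s2: "s2 ''b'' 0 = card ?B \<and> s2 ''a'' 0 = card ?X \<and> s2 ''n'' 0 = n \<and> s2 ''B'' = s ''B'' \<and> s2 (trial 0) = s (trial 0)" for s2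
  proof (rule runs_If)
    assume less: "bval (Less (V ''b'') (V ''a'')) s2"
    have "runs (copy (trial 0) ''B'') s2 (9 + n * 18) (\<lambda>s'. graph_of n (s' ''B'') = graph_of n (s2 (trial 0)))"
      by (rule runs_copy) (use s2 in auto)
    then show "runs (copy (trial 0) ''B'') s2 (9 + n * 18) ?Q"
      by (rule runs_weaken) (use less s2 in \<open>auto simp: best_of_def\<close>)
  next
    assume "\<not> bval (Less (V ''b'') (V ''a'')) s2"
    then have "?Q s2" using s2 by (auto simp: best_of_def)
    from runs_SKIP[of ?Q s2, OF this] show "runs SKIP s2 (9 + n * 18) ?Q" by (rule runs_weaken) auto
  qed
  have "runs update s ((12 + n * 24) + ((12 + n * 24) + (1 + bcost (Less (V ''b'') (V ''a'')) + (9 + n * 18)))) ?Q"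
    unfolding update_def
    by (rule runs_Seq, rule runs_weaken[OF 1 order_refl], rule runs_Seq, rule runs_weaken[OF 2 order_refl], assumption, rule 3)
  then show ?thesis by (rule runs_weaken) auto
qed



text \<open>Nested loops over the edge list, one for each edge to be forced. The array
  \<open>trial r\<close> holds the matching when \<open>r\<close> edges are still to be forced; the
  innermost level compares \<open>trial 0\<close> with the best matching \<open>B\<close> so
  far.\<close>

primrec search :: "nat \<Rightarrow> com" where
  "search 0 = update"
| "search (Suc r) = FOR (index r) ''m'' (Seq (force_edge_com (index r) (trial (Suc r)) (trial r)) (search r))"

lemma assigned_search: "assigned (search r) =
    {''x'', ''a'', ''b'', ''B''} \<union> trial ` {..<r} \<union> index ` {..<r}"
  by (induction r) (auto simp: lessThan_Suc)

lemma assigned_search_iff [simp]: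
  "trial i \<in> assigned (search r) \<longleftrightarrow> i < r"
  "index i \<in> assigned (search r) \<longleftrightarrow> i < r"
  by (auto simp: assigned_search)

lemma literal_not_assigned_search [simp]:
  "''n'' \<notin> assigned (search r)" "''m'' \<notin> assigned (search r)" "''I'' \<notin> assigned (search r)"
  "''J'' \<notin> assigned (search r)" "''y'' \<notin> assigned (search r)" "''M'' \<notin> assigned (search r)"
  by (auto simp: assigned_search)

definition edge_list :: "nat \<Rightarrow> state \<Rightarrow> (nat \<times> nat) set" where
  "edge_list m s = (\<lambda>k. (s ''I'' k, s ''J'' k)) ` {1..m}"

primrec search_cost :: "nat \<Rightarrow> nat \<Rightarrow> nat \<Rightarrow> nat" where
  "search_cost n m 0 = 66 * n + 39"
| "search_cost n m (Suc r) = 9 + m * (12 + ((100 * n + 100) + search_cost n m r))"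

text \<open>The invariant compares \<open>B\<close> with the candidates whose first forced edge is
  among the first \<open>i\<close> of the list, and \<open>best_of_trans\<close> adds those of the
  next one. Inner levels write only to arrays of smaller number, so \<open>trial (Suc r)\<close>
  stays intact throughout the loop.\<close>

lemma runs_search:
  assumes "s ''n'' 0 = n" "s ''m'' 0 = m" "edge_list m s \<subseteq> {1..n} \<times> {1..n}"
  shows "runs (search r) s (search_cost n m r)
    (\<lambda>s'. best_of (graph_of n (s ''B'')) (candidates (edge_list m s) r (graph_of n (s (trial r)))) (graph_of n (s' ''B'')))"
  using assms
proof (induction r arbitrary: s)
  case 0
  then show ?case using runs_update[of s n] by simp
next
  case (Suc r)
  let ?X = "graph_of n (s (trial (Suc r)))" and ?B = "graph_of n (s ''B'')" and ?E = "edge_list m s"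
  let ?f = "\<lambda>k. (s ''I'' k, s ''J'' k)"
  let ?c = "Seq (force_edge_com (index r) (trial (Suc r)) (trial r)) (search r)"
  define Inv where "Inv i s' \<longleftrightarrow>
    best_of ?B (\<Union>k\<in>{1..i}. candidates ?E r (force_edge (?f k) ?X)) (graph_of n (s' ''B''))" for i and s' :: state
  have "runs (FOR (index r) ''m'' ?c) s (9 + m * (12 + ((100 * n + 100) + search_cost n m r)))
      (\<lambda>s'. Inv m s' \<and> (\<forall>v. v \<notin> insert (index r) (assigned ?c) \<longrightarrow> s' v = s v))"
  proof (rule runs_FOR)
    fix i s' assume A: "i < m" "Inv i s'" "s' (index r) 0 = Suc i"
      "\<forall>v. v \<notin> insert (index r) (assigned ?c) \<longrightarrow> s' v = s v"
    have same: "s' (trial (Suc r)) = s (trial (Suc r))" "s' ''I'' = s ''I''" "s' ''J'' = s ''J''" "s' ''n'' = s ''n''" "s' ''m'' = s ''m''"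
      using A(4) by auto
    have "?f (Suc i) \<in> ?E" using A(1) by (auto simp: edge_list_def)
    then have range: "s ''I'' (Suc i) \<in> {1..n}" "s ''J'' (Suc i) \<in> {1..n}" using Suc.prems(3) by auto
    have "runs (force_edge_com (index r) (trial (Suc r)) (trial r)) s' (100 * n + 100) (\<lambda>s'a. graph_of n (s'a (trial r)) =
      force_edge (s' ''I'' (s' (index r) 0), s' ''J'' (s' (index r) 0)) (graph_of n (s' (trial (Suc r)))))"
      by (rule runs_force_edge_com) (use same range A Suc.prems in auto)
    from runs_frame[OF this]
    have 1: "runs (force_edge_com (index r) (trial (Suc r)) (trial r)) s' (100 * n + 100)
      (\<lambda>s1. graph_of n (s1 (trial r)) = force_edge (?f (Suc i)) ?X \<and> (\<forall>v. v \<notin> {''x'', trial r} \<longrightarrow> s1 v = s' v))"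
      by (rule runs_weaken) (use same A in auto)
    have 2: "runs (search r) s1 (search_cost n m r) (Inv (Suc i))"
      if s1: "graph_of n (s1 (trial r)) = force_edge (?f (Suc i)) ?X \<and> (\<forall>v. v \<notin> {''x'', trial r} \<longrightarrow> s1 v = s' v)" for s1
    proof -
      have E: "edge_list m s1 = ?E" using s1 same by (auto simp: edge_list_def)
      have B: "s1 ''B'' = s' ''B''" using s1 by auto
      have "runs (search r) s1 (search_cost n m r)
        (\<lambda>s2. best_of (graph_of n (s1 ''B'')) (candidates (edge_list m s1) r (graph_of n (s1 (trial r)))) (graph_of n (s2 ''B'')))"
        by (rule Suc.IH) (use s1 same Suc.prems E in auto)
      then show ?thesis
      proof (rule runs_weaken[OF _ order_refl])
        fix s2 assume "best_of (graph_of n (s1 ''B'')) (candidates (edge_list m s1) r (graph_of n (s1 (trial r)))) (graph_of n (s2 ''B''))"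
        then have "best_of (graph_of n (s' ''B'')) (candidates ?E r (force_edge (?f (Suc i)) ?X)) (graph_of n (s2 ''B''))"
          using s1 E B by simp
        from best_of_trans[OF A(2)[unfolded Inv_def] this] show "Inv (Suc i) s2"
          by (simp add: Inv_def atLeastAtMostSuc_conv Un_commute)
      qed
    qed
    show "runs ?c s' ((100 * n + 100) + search_cost n m r) (Inv (Suc i))"
      by (rule runs_Seq, rule runs_weaken[OF 1 order_refl], rule 2)
  qed (use Suc.prems in \<open>auto simp: Inv_def best_of_empty\<close>)
  then have *: "runs (search (Suc r)) s (search_cost n m (Suc r))
      (\<lambda>s'. Inv m s' \<and> (\<forall>v. v \<notin> insert (index r) (assigned ?c) \<longrightarrow> s' v = s v))" by simp
  have "(\<Union>k\<in>{1..m}. candidates ?E r (force_edge (?f k) ?X)) = candidates ?E (Suc r) ?X"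
    by (simp add: edge_list_def)
  then show ?case by (intro runs_weaken[OF * order_refl]) (simp add: Inv_def)
qed

section \<open>Rounds of local search\<close>

definition round_com :: "nat \<Rightarrow> com" where
  "round_com K = Seq (copy ''B'' (trial K)) (search K)"

text \<open>A round that does not change \<open>B\<close> shows that \<open>B\<close> is locally
  optimal, and any other round enlarges \<open>B\<close>. After \<open>n\<close> rounds
  \<open>B\<close> is locally optimal or has at least \<open>n\<close> edges, and no matching has
  more than \<open>n\<close>.\<close>

lemma runs_rounds:
  assumes s: "s ''n'' 0 = n" "s ''m'' 0 = m" "edge_list m s = E" "E \<subseteq> {1..n} \<times> {1..n}" "s ''B'' = (\<lambda>_. 0)"
  shows "runs (FOR ''y'' ''n'' (round_com K)) s (9 + n * (12 + ((9 + n * 18) + search_cost n m K)))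
    (\<lambda>s'. consecutive_matching E (graph_of n (s' ''B'')) \<and>
      (\<forall>Y\<in>candidates E K (graph_of n (s' ''B'')). card Y \<le> card (graph_of n (s' ''B''))) \<and>
      s' ''M'' = s ''M'' \<and> s' ''n'' = s ''n'')"
proof -
  define Inv where "Inv i s' \<longleftrightarrow> consecutive_matching E (graph_of n (s' ''B'')) \<and>
    (i \<le> card (graph_of n (s' ''B'')) \<or> (\<forall>Y\<in>candidates E K (graph_of n (s' ''B'')). card Y \<le> card (graph_of n (s' ''B''))))"
    for i and s' :: state
  have "runs (FOR ''y'' ''n'' (round_com K)) s (9 + n * (12 + ((9 + n * 18) + search_cost n m K)))
      (\<lambda>s'. Inv n s' \<and> (\<forall>v. v \<notin> insert ''y'' (assigned (round_com K)) \<longrightarrow> s' v = s v))"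
  proof (rule runs_FOR)
    fix i s' assume A: "i < n" "Inv i s'" "s' ''y'' 0 = Suc i"
      "\<forall>v. v \<notin> insert ''y'' (assigned (round_com K)) \<longrightarrow> s' v = s v"
    let ?B = "graph_of n (s' ''B'')"
    have same: "s' ''n'' = s ''n''" "s' ''m'' = s ''m''" "s' ''I'' = s ''I''" "s' ''J'' = s ''J''"
      using A(4) by (auto simp: round_com_def)
    have "runs (copy ''B'' (trial K)) s' (9 + n * 18) (\<lambda>s1. graph_of n (s1 (trial K)) = ?B)"
      by (rule runs_copy) (use same s in auto)
    from runs_frame[OF this]
    have 1: "runs (copy ''B'' (trial K)) s' (9 + n * 18)
        (\<lambda>s1. graph_of n (s1 (trial K)) = ?B \<and> (\<forall>v. v \<notin> {''x'', trial K} \<longrightarrow> s1 v = s' v))" by simp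
    have 2: "runs (search K) s1 (search_cost n m K) (Inv (Suc i))"
      if s1: "graph_of n (s1 (trial K)) = ?B \<and> (\<forall>v. v \<notin> {''x'', trial K} \<longrightarrow> s1 v = s' v)" for s1
    proof -
      have E: "edge_list m s1 = E" using s1 same s by (auto simp: edge_list_def)
      have B: "s1 ''B'' = s' ''B''" using s1 by auto
      have "runs (search K) s1 (search_cost n m K)
        (\<lambda>s2. best_of (graph_of n (s1 ''B'')) (candidates (edge_list m s1) K (graph_of n (s1 (trial K)))) (graph_of n (s2 ''B'')))"
        by (rule runs_search) (use s1 same s E in auto)
      then show ?thesis
      proof (rule runs_weaken[OF _ order_refl])
        fix s2 assume "best_of (graph_of n (s1 ''B'')) (candidates (edge_list m s1) K (graph_of n (s1 (trial K)))) (graph_of n (s2 ''B''))"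
        then have best: "best_of ?B (candidates E K ?B) (graph_of n (s2 ''B''))" using s1 E B by simp
        have cm: "consecutive_matching E ?B" using A(2) by (simp add: Inv_def)
        show "Inv (Suc i) s2"
        proof (cases "graph_of n (s2 ''B'') = ?B")
          case True
          with best cm show ?thesis by (auto simp: Inv_def best_of_def)
        next
          case False
          with best have c: "graph_of n (s2 ''B'') \<in> candidates E K ?B" "card ?B < card (graph_of n (s2 ''B''))"
            by (auto simp: best_of_def)
          \<comment> \<open>A larger candidate exists, so \<open>?B\<close> was not locally optimal
            and the other alternative of the invariant applies.\<close>
          then have "i \<le> card ?B" using A(2) by (force simp: Inv_def)
          with c candidates_consecutive[OF cm c(1)] show ?thesis by (auto simp: Inv_def)
        qed
      qed
    qed
    show "runs (round_com K) s' ((9 + n * 18) + search_cost n m K) (Inv (Suc i))"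
      unfolding round_com_def by (rule runs_Seq, rule runs_weaken[OF 1 order_refl], rule 2)
  next
    have "graph_of n (s ''B'') = {}" using s by (simp add: graph_of_def)
    then show "Inv 0 s" by (simp add: Inv_def consecutive_matching_iff)
  qed (use s in \<open>auto simp: Inv_def round_com_def\<close>)
  then show ?thesis
  proof (rule runs_weaken[OF _ order_refl])
    fix s' assume A: "Inv n s' \<and> (\<forall>v. v \<notin> insert ''y'' (assigned (round_com K)) \<longrightarrow> s' v = s v)"
    let ?B = "graph_of n (s' ''B'')"
    have cm: "consecutive_matching E ?B" using A by (simp add: Inv_def)
    have "card Y \<le> card ?B" if Y: "Y \<in> candidates E K ?B" for Y
    proof (cases "n \<le> card ?B")
      case True
      have Y': "consecutive_matching E Y" by (rule candidates_consecutive[OF cm Y])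
      then have "fst ` Y \<subseteq> {1..n}" using s(4) by (auto simp: consecutive_matching_iff)
      from card_inj_on_le[OF consecutive_matching_inj(1)[OF Y'] this] True show ?thesis by simp
    next
      case False
      then show ?thesis using A Y by (auto simp: Inv_def)
    qed
    then show "consecutive_matching E ?B \<and> (\<forall>Y\<in>candidates E K ?B. card Y \<le> card ?B) \<and> s' ''M'' = s ''M'' \<and> s' ''n'' = s ''n''"
      using A cm by (auto simp: round_com_def)
  qed
qed

section \<open>Reading the graph and writing the matching\<close>

text \<open>The offset \<open>x * n\<close> of a row is accumulated in \<open>s\<close> by
  additions. The list starts at index 1, in accordance with \<open>FOR\<close>.\<close>

definition list_edges :: com where
  "list_edges = FOR ''x'' ''n'' (Seq (Assign ''s'' (N 0) (Plus (V ''s'') (V ''n'')))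
     (FOR ''y'' ''n'' (If (Less (N 0) (Arr ''E'' (Plus (V ''s'') (V ''y''))))
        (Seq (Assign ''m'' (N 0) (Plus (V ''m'') (N 1)))
          (Seq (Assign ''I'' (V ''m'') (V ''x'')) (Assign ''J'' (V ''m'') (V ''y''))))
        SKIP)))"

lemma edge_list_Suc: "edge_list (Suc m) s = insert (s ''I'' (Suc m), s ''J'' (Suc m)) (edge_list m s)"
  by (simp add: edge_list_def atLeastAtMostSuc_conv)

lemma edge_list_cong:
  "(\<And>k. k \<in> {1..m} \<Longrightarrow> s ''I'' k = s' ''I'' k \<and> s ''J'' k = s' ''J'' k) \<Longrightarrow> edge_list m s = edge_list m s'"
  by (auto simp: edge_list_def)

lemma runs_list_edges:
  assumes s: "s ''n'' 0 = n" "s ''m'' 0 = 0" "s ''s'' 0 = 0"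
  shows "runs list_edges s (9 + n * (12 + (7 + (9 + n * (12 + 30)))))
    (\<lambda>s'. edge_list (s' ''m'' 0) s' = edges_of n (s ''E'') \<and> s' ''m'' 0 \<le> n * n \<and>
      (\<forall>v. v \<notin> {''x'', ''y'', ''s'', ''m'', ''I'', ''J''} \<longrightarrow> s' v = s v))"
proof -
  let ?E = "edges_of n (s ''E'')"
  let ?c1 = "Seq (Assign ''m'' (N 0) (Plus (V ''m'') (N 1)))
          (Seq (Assign ''I'' (V ''m'') (V ''x'')) (Assign ''J'' (V ''m'') (V ''y'')))"
  let ?c2 = "If (Less (N 0) (Arr ''E'' (Plus (V ''s'') (V ''y'')))) ?c1 SKIP"
  let ?c3 = "Seq (Assign ''s'' (N 0) (Plus (V ''s'') (V ''n''))) (FOR ''y'' ''n'' ?c2)"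
  define Inv where "Inv i s' \<longleftrightarrow> s' ''s'' 0 = i * n \<and> s' ''m'' 0 \<le> i * n \<and>
    edge_list (s' ''m'' 0) s' = {e \<in> ?E. fst e \<le> i}" for i and s' :: state
  have "runs (FOR ''x'' ''n'' ?c3) s (9 + n * (12 + (7 + (9 + n * (12 + 30)))))
      (\<lambda>s'. Inv n s' \<and> (\<forall>v. v \<notin> insert ''x'' (assigned ?c3) \<longrightarrow> s' v = s v))"
  proof (rule runs_FOR)
    fix i s' assume A: "i < n" "Inv i s'" "s' ''x'' 0 = Suc i"
      "\<forall>v. v \<notin> insert ''x'' (assigned ?c3) \<longrightarrow> s' v = s v"
    let ?s = "s'(''s'' := (s' ''s'')(aval (N 0) s' := aval (Plus (V ''s'') (V ''n'')) s'))"
    have sn: "s' ''n'' 0 = n" "s' ''E'' = s ''E''" using A(4) s by auto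
    define Inv' where "Inv' j s1 \<longleftrightarrow> s1 ''m'' 0 \<le> i * n + j \<and>
      edge_list (s1 ''m'' 0) s1 = {e \<in> ?E. fst e \<le> i \<or> fst e = Suc i \<and> snd e \<le> j}" for j and s1 :: state
    have "runs (FOR ''y'' ''n'' ?c2) ?s (9 + n * (12 + 30))
      (\<lambda>s1. Inv' n s1 \<and> (\<forall>v. v \<notin> insert ''y'' (assigned ?c2) \<longrightarrow> s1 v = ?s v))"
    proof (rule runs_FOR)
      fix j s1 assume B: "j < n" "Inv' j s1" "s1 ''y'' 0 = Suc j"
        "\<forall>v. v \<notin> insert ''y'' (assigned ?c2) \<longrightarrow> s1 v = ?s v"
      have vals: "s1 ''x'' 0 = Suc i" "s1 ''s'' 0 = Suc i * n" "s1 ''E'' = s ''E''"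
        using A B(4) sn by (auto simp: Inv_def)
      have mem: "(Suc i, Suc j) \<in> ?E \<longleftrightarrow> 0 < s ''E'' (Suc i * n + Suc j)"
        using A(1) B(1) by (auto simp: edges_of_def)
      have test: "bval (Less (N 0) (Arr ''E'' (Plus (V ''s'') (V ''y'')))) s1 \<longleftrightarrow> (Suc i, Suc j) \<in> ?E"
        unfolding mem using vals B(3) by simp
      have step: "{e \<in> ?E. fst e \<le> i \<or> fst e = Suc i \<and> snd e \<le> Suc j} =
          {e \<in> ?E. fst e \<le> i \<or> fst e = Suc i \<and> snd e \<le> j} \<union> ({(Suc i, Suc j)} \<inter> ?E)"
        by (auto simp: le_Suc_eq)
      have "runs ?c2 s1 (1 + bcost (Less (N 0) (Arr ''E'' (Plus (V ''s'') (V ''y'')))) + 18) (Inv' (Suc j))"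
      proof (rule runs_If)
        assume t: "bval (Less (N 0) (Arr ''E'' (Plus (V ''s'') (V ''y'')))) s1"
        let ?m = "s1 ''m'' 0"
        have "runs ?c1 s1 ((1 + acost (N 0) + acost (Plus (V ''m'') (N 1))) +
            ((1 + acost (V ''m'') + acost (V ''x'')) + (1 + acost (V ''m'') + acost (V ''y'')))) (Inv' (Suc j))"
        proof (intro runs_Seq runs_Assign)
          let ?s2 = "s1(''m'' := (s1 ''m'')(aval (N 0) s1 := aval (Plus (V ''m'') (N 1)) s1))"
          let ?s3 = "?s2(''I'' := (?s2 ''I'')(aval (V ''m'') ?s2 := aval (V ''x'') ?s2))"
          let ?s4 = "?s3(''J'' := (?s3 ''J'')(aval (V ''m'') ?s3 := aval (V ''y'') ?s3))"
          have m: "?s4 ''m'' 0 = Suc ?m" by simp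
          have new: "?s4 ''I'' (Suc ?m) = Suc i" "?s4 ''J'' (Suc ?m) = Suc j" using vals B(3) by simp_all
          have "edge_list ?m ?s4 = edge_list ?m s1" by (rule edge_list_cong) simp
          then have "edge_list (Suc ?m) ?s4 = insert (Suc i, Suc j) (edge_list ?m s1)"
            unfolding edge_list_Suc new by simp
          then show "Inv' (Suc j) ?s4"
            using B(2) test t unfolding Inv'_def m step by auto
        qed
        then show "runs ?c1 s1 18 (Inv' (Suc j))" by (rule runs_weaken) auto
      next
        assume t: "\<not> bval (Less (N 0) (Arr ''E'' (Plus (V ''s'') (V ''y'')))) s1"
        then have "Inv' (Suc j) s1" using B(2) test unfolding Inv'_def step by auto
        from runs_SKIP[of "Inv' (Suc j)" s1, OF this] show "runs SKIP s1 18 (Inv' (Suc j))"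
          by (rule runs_weaken) auto
      qed
      then show "runs ?c2 s1 30 (Inv' (Suc j))" by (rule runs_weaken) auto
    next
      show "Inv' j (s1(''y'' := f))" if "Inv' j s1" for j s1 f
        using that by (simp add: Inv'_def edge_list_def)
      have "edge_list m ?s = edge_list m s'" for m by (simp add: edge_list_def)
      moreover have "{e \<in> ?E. fst e \<le> i \<or> fst e = Suc i \<and> snd e \<le> 0} = {e \<in> ?E. fst e \<le> i}"
        by (auto simp: edges_of_def)
      ultimately show "Inv' 0 ?s" using A(2) by (simp add: Inv'_def Inv_def)
    qed (use sn in auto)
    then have "runs ?c3 s' ((1 + acost (N 0) + acost (Plus (V ''s'') (V ''n''))) + (9 + n * (12 + 30)))
        (\<lambda>s1. Inv' n s1 \<and> (\<forall>v. v \<notin> insert ''y'' (assigned ?c2) \<longrightarrow> s1 v = ?s v))"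
      by (intro runs_Seq runs_Assign)
    then show "runs ?c3 s' (7 + (9 + n * (12 + 30))) (Inv (Suc i))"
    proof (rule runs_weaken)
      fix s1 assume B: "Inv' n s1 \<and> (\<forall>v. v \<notin> insert ''y'' (assigned ?c2) \<longrightarrow> s1 v = ?s v)"
      have "s1 ''s'' 0 = Suc i * n" using A B sn by (auto simp: Inv_def)
      moreover have "{e \<in> ?E. fst e \<le> i \<or> fst e = Suc i \<and> snd e \<le> n} = {e \<in> ?E. fst e \<le> Suc i}"
        by (auto simp: edges_of_def le_Suc_eq)
      ultimately show "Inv (Suc i) s1" using B by (simp add: Inv_def Inv'_def)
    qed simp
  next
    show "Inv i (s'(''x'' := f))" if "Inv i s'" for i s' f
      using that by (simp add: Inv_def edge_list_def)
    show "Inv 0 s" using s by (auto simp: Inv_def edge_list_def edges_of_def)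
  qed (use s in auto)
  then have "runs list_edges s (9 + n * (12 + (7 + (9 + n * (12 + 30)))))
      (\<lambda>s'. Inv n s' \<and> (\<forall>v. v \<notin> insert ''x'' (assigned ?c3) \<longrightarrow> s' v = s v))" by (simp add: list_edges_def)
  moreover have "{e \<in> ?E. fst e \<le> n} = ?E" by (auto simp: edges_of_def)
  ultimately show ?thesis by (elim runs_weaken) (auto simp: Inv_def)
qed

definition write_matching :: com where
  "write_matching = Seq (Assign ''s'' (N 0) (N 0)) (FOR ''x'' ''n'' (Seq (Assign ''s'' (N 0) (Plus (V ''s'') (V ''n'')))
     (If (Less (N 0) (Arr ''B'' (V ''x''))) (Assign ''M'' (Plus (V ''s'') (Arr ''B'' (V ''x''))) (N 1)) SKIP)))"

text \<open>As \<open>M\<close> is zero at the beginning, its nonzero cells are those written here,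
  and \<open>cell_inject\<close> recovers each edge from its cell.\<close>

lemma runs_write_matching:
  assumes s: "s ''n'' 0 = n" "s ''M'' = (\<lambda>_. 0)" "graph_of n (s ''B'') \<subseteq> {1..n} \<times> {1..n}"
  shows "runs write_matching s (12 + n * 40) (\<lambda>s'. output_edges n s' = graph_of n (s ''B''))"
proof -
  let ?B = "s ''B''"
  let ?c1 = "If (Less (N 0) (Arr ''B'' (V ''x''))) (Assign ''M'' (Plus (V ''s'') (Arr ''B'' (V ''x''))) (N 1)) SKIP"
  let ?c2 = "Seq (Assign ''s'' (N 0) (Plus (V ''s'') (V ''n''))) ?c1"
  let ?s = "s(''s'' := (s ''s'')(aval (N 0) s := aval (N 0) s))"
  define Inv where "Inv i s' \<longleftrightarrow> s' ''s'' 0 = i * n \<and>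
    (\<forall>k. s' ''M'' k \<noteq> 0 \<longleftrightarrow> (\<exists>x\<in>{1..i}. ?B x \<noteq> 0 \<and> k = x * n + ?B x))" for i and s' :: state
  have *: "runs (FOR ''x'' ''n'' ?c2) ?s (9 + n * (12 + 25)) (\<lambda>s'. Inv n s' \<and> (\<forall>v. v \<notin> insert ''x'' (assigned ?c2) \<longrightarrow> s' v = ?s v))"
  proof (rule runs_FOR)
    fix i s' assume A: "i < n" "Inv i s'" "s' ''x'' 0 = Suc i"
      "\<forall>v. v \<notin> insert ''x'' (assigned ?c2) \<longrightarrow> s' v = ?s v"
    let ?s1 = "s'(''s'' := (s' ''s'')(aval (N 0) s' := aval (Plus (V ''s'') (V ''n'')) s'))"
    have same: "s' ''B'' = ?B" "s' ''n'' 0 = n" using A(4) s by auto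
    have split: "(\<exists>x\<in>{1..Suc i}. Q x) \<longleftrightarrow> (\<exists>x\<in>{1..i}. Q x) \<or> Q (Suc i)" for Q
      by (simp add: atLeastAtMostSuc_conv disj_commute)
    have "runs ?c1 ?s1 (1 + bcost (Less (N 0) (Arr ''B'' (V ''x''))) + 8) (Inv (Suc i))"
    proof (rule runs_If)
      assume t: "bval (Less (N 0) (Arr ''B'' (V ''x''))) ?s1"
      have "Inv (Suc i) (?s1(''M'' := (?s1 ''M'')(aval (Plus (V ''s'') (Arr ''B'' (V ''x''))) ?s1 := aval (N 1) ?s1)))"
        using t A(2,3) same unfolding Inv_def split by (auto simp: add.commute)
      from runs_Assign[of "Inv (Suc i)", OF this]
      show "runs (Assign ''M'' (Plus (V ''s'') (Arr ''B'' (V ''x''))) (N 1)) ?s1 8 (Inv (Suc i))"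
        by (rule runs_weaken) auto
    next
      assume t: "\<not> bval (Less (N 0) (Arr ''B'' (V ''x''))) ?s1"
      then have "Inv (Suc i) ?s1" using A(2,3) same unfolding Inv_def split by auto
      from runs_SKIP[of "Inv (Suc i)" ?s1, OF this] show "runs SKIP ?s1 8 (Inv (Suc i))"
        by (rule runs_weaken) auto
    qed
    then have "runs ?c2 s' ((1 + acost (N 0) + acost (Plus (V ''s'') (V ''n''))) +
        (1 + bcost (Less (N 0) (Arr ''B'' (V ''x''))) + 8)) (Inv (Suc i))"
      by (intro runs_Seq runs_Assign)
    then show "runs ?c2 s' 25 (Inv (Suc i))" by (rule runs_weaken) auto
  qed (use s in \<open>auto simp: Inv_def\<close>)
  have "runs write_matching s ((1 + acost (N 0) + acost (N 0)) + (9 + n * (12 + 25)))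
      (\<lambda>s'. Inv n s' \<and> (\<forall>v. v \<notin> insert ''x'' (assigned ?c2) \<longrightarrow> s' v = ?s v))"
    unfolding write_matching_def by (intro runs_Seq runs_Assign *)
  then show ?thesis
  proof (rule runs_weaken)
    fix s' assume "Inv n s' \<and> (\<forall>v. v \<notin> insert ''x'' (assigned ?c2) \<longrightarrow> s' v = ?s v)"
    then have M: "s' ''M'' k \<noteq> 0 \<longleftrightarrow> (\<exists>x\<in>{1..n}. ?B x \<noteq> 0 \<and> k = x * n + ?B x)" for k
      by (simp add: Inv_def)
    have range: "?B x \<in> {1..n}" if "x \<in> {1..n}" "?B x \<noteq> 0" for x
      using s(3) that by (auto simp: graph_of_def)
    have "(i, j) \<in> output_edges n s' \<longleftrightarrow> (i, j) \<in> graph_of n ?B" for i j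
    proof
      assume "(i, j) \<in> output_edges n s'"
      then have ij: "i \<in> {1..n}" "j \<in> {1..n}" "s' ''M'' (i * n + j) \<noteq> 0" by (auto simp: output_edges_def edges_of_def)
      then obtain x where x: "x \<in> {1..n}" "?B x \<noteq> 0" "i * n + j = x * n + ?B x" using M by blast
      from cell_inject[OF x(3) ij(2) range[OF x(1,2)]] x show "(i, j) \<in> graph_of n ?B"
        by (auto simp: graph_of_def)
    next
      assume "(i, j) \<in> graph_of n ?B"
      then have ij: "i \<in> {1..n}" "?B i \<noteq> 0" "j = ?B i" by (auto simp: graph_of_def)
      then have "s' ''M'' (i * n + j) \<noteq> 0" unfolding M by blast
      then show "(i, j) \<in> output_edges n s'" using ij range[OF ij(1,2)] by (auto simp: output_edges_def edges_of_def)
    qed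
    then show "output_edges n s' = graph_of n ?B" by auto
  qed auto
qed

section \<open>The whole algorithm and its running time\<close>

definition algorithm :: "nat \<Rightarrow> com" where
  "algorithm K = Seq list_edges (Seq (FOR ''y'' ''n'' (round_com K)) write_matching)"

definition total_cost :: "nat \<Rightarrow> nat \<Rightarrow> nat" where
  "total_cost n K = (9 + n * (12 + (7 + (9 + n * (12 + 30))))) +
     ((9 + n * (12 + ((9 + n * 18) + search_cost n (n * n) K))) + (12 + n * 40))"

lemma search_cost_mono: "m \<le> m' \<Longrightarrow> search_cost n m r \<le> search_cost n m' r"
  by (induction r) (auto intro!: mult_le_mono add_mono)

lemma runs_algorithm:
  assumes E: "bipartite_instance n E"
  shows "runs (algorithm K) (input_state n E) (total_cost n K) (\<lambda>s. consecutive_matching E (output_edges n s) \<and>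
    (\<forall>Y\<in>candidates E K (output_edges n s). card Y \<le> card (output_edges n s)))"
proof -
  let ?s = "input_state n E"
  let ?Q = "\<lambda>X. consecutive_matching E X \<and> (\<forall>Y\<in>candidates E K X. card Y \<le> card X)"
  have E': "E \<subseteq> {1..n} \<times> {1..n}" using E by (simp add: bipartite_instance_def)
  have s: "?s ''n'' 0 = n" "?s ''m'' 0 = 0" "?s ''s'' 0 = 0" "?s ''B'' = (\<lambda>_. 0)" "?s ''M'' = (\<lambda>_. 0)"
    by (auto simp: input_state_def)
  have 1: "runs list_edges ?s (9 + n * (12 + (7 + (9 + n * (12 + 30)))))
    (\<lambda>s1. edge_list (s1 ''m'' 0) s1 = E \<and> s1 ''m'' 0 \<le> n * n \<and>
      (\<forall>v. v \<notin> {''x'', ''y'', ''s'', ''m'', ''I'', ''J''} \<longrightarrow> s1 v = ?s v))"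
    using runs_list_edges[of ?s n, OF s(1-3)] edges_of_input_state[OF E] by simp
  have 2: "runs (FOR ''y'' ''n'' (round_com K)) s1 (9 + n * (12 + ((9 + n * 18) + search_cost n (n * n) K)))
    (\<lambda>s2. ?Q (graph_of n (s2 ''B'')) \<and> s2 ''M'' = (\<lambda>_. 0) \<and> s2 ''n'' 0 = n)"
    if s1: "edge_list (s1 ''m'' 0) s1 = E \<and> s1 ''m'' 0 \<le> n * n \<and>
      (\<forall>v. v \<notin> {''x'', ''y'', ''s'', ''m'', ''I'', ''J''} \<longrightarrow> s1 v = ?s v)" for s1
  proof -
    have "s1 ''n'' 0 = n" "s1 ''B'' = (\<lambda>_. 0)" "s1 ''M'' = (\<lambda>_. 0)" using s1 s by auto
    moreover have "search_cost n (s1 ''m'' 0) K \<le> search_cost n (n * n) K"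
      using s1 by (intro search_cost_mono) simp
    ultimately show ?thesis
      using s1 E' by (intro runs_weaken[OF runs_rounds[of s1 n "s1 ''m'' 0" E K]]) auto
  qed
  have 3: "runs write_matching s2 (12 + n * 40) (\<lambda>s3. ?Q (output_edges n s3))"
    if s2: "?Q (graph_of n (s2 ''B'')) \<and> s2 ''M'' = (\<lambda>_. 0) \<and> s2 ''n'' 0 = n" for s2
  proof -
    have "graph_of n (s2 ''B'') \<subseteq> {1..n} \<times> {1..n}" using s2 E' by (auto simp: consecutive_matching_iff)
    then show ?thesis using s2 by (intro runs_weaken[OF runs_write_matching[of s2 n]]) auto
  qed
  show ?thesis unfolding algorithm_def total_cost_def
    by (rule runs_Seq, rule runs_weaken[OF 1 order_refl], rule runs_Seq, rule runs_weaken[OF 2 order_refl], assumption, rule 3)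
qed

text \<open>A level costs at most \<open>n * n\<close> times a linear term plus the cost of the
  level below, so the factor \<open>n ^ 14\<close> per level is generous. For
  \<open>2 \<le> n\<close>, constants are absorbed by powers of \<open>n\<close>, for instance 128
  by \<open>n ^ 7\<close>.\<close>

lemma search_cost_le:
  assumes n: "2 \<le> n"
  shows "search_cost n (n * n) r \<le> n ^ (14 * (r + 1))"
proof (induction r)
  have p: "2 ^ k \<le> n ^ k" for k using n by (rule power_mono) simp
  {
    case 0
    have "66 * n + 39 \<le> 128 * n" using n by simp
    also have "\<dots> \<le> n ^ 7 * n" using p[of 7] by (intro mult_right_mono) auto
    also have "\<dots> = n ^ 8" by (simp flip: power_Suc2)
    also have "\<dots> \<le> n ^ 14" using n by (intro power_increasing) auto
    finally show ?case by simp
  next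
    case (Suc r)
    define Y where "Y = n ^ (14 * (r + 1))"
    have "112 + 100 * n \<le> 256 * n" using n by simp
    also have "\<dots> \<le> n ^ 8 * n" using p[of 8] by (intro mult_right_mono) auto
    also have "\<dots> = n ^ 9" by (simp flip: power_Suc2)
    also have "\<dots> \<le> Y" unfolding Y_def using n by (intro power_increasing) auto
    finally have 1: "112 + 100 * n \<le> Y" .
    have "search_cost n (n * n) (Suc r) = 9 + n * n * ((112 + 100 * n) + search_cost n (n * n) r)"
      by simp
    also have "\<dots> \<le> 9 + n * n * (Y + Y)"
      using 1 Suc unfolding Y_def by (intro add_left_mono mult_left_mono add_mono) auto
    also have "\<dots> \<le> n * n * Y + n * n * (Y + Y)"
    proof -
      have "9 \<le> Y" using 1 by simp
      also have "\<dots> \<le> n * n * Y" using n by simp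
      finally show ?thesis by simp
    qed
    also have "\<dots> = 3 * (n * n * Y)" by simp
    also have "\<dots> \<le> (n * n) * (n * n * Y)"
      using n mult_le_mono[OF n n] by (intro mult_right_mono) auto
    also have "\<dots> = n ^ 4 * Y" by (simp add: power4_eq_xxxx)
    also have "\<dots> \<le> n ^ 14 * Y" using n by (intro mult_right_mono power_increasing) auto
    also have "\<dots> = n ^ (14 * (Suc r + 1))" unfolding Y_def by (simp flip: power_add)
    finally show ?case .
  }
qed

text \<open>The \<open>n\<close> rounds and the quadratic terms for input and copying fit into one
  further factor \<open>n ^ 14\<close>.\<close>

lemma total_cost_le:
  assumes n: "2 \<le> n"
  shows "total_cost n K \<le> n ^ (14 * (K + 2))"
proof -
  define Y where "Y = n ^ (14 * (K + 1))"
  have p: "2 ^ k \<le> n ^ k" for k using n by (rule power_mono) simp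
  have nn: "2 * n \<le> n * n" "4 \<le> n * n" using n mult_le_mono[OF n n] by auto
  have "total_cost n K = 30 + 89 * n + 60 * (n * n) + n * search_cost n (n * n) K"
    by (simp add: total_cost_def algebra_simps)
  also have "\<dots> \<le> 128 * (n * n) + n * Y"
  proof (rule add_mono)
    show "30 + 89 * n + 60 * (n * n) \<le> 128 * (n * n)" using nn by linarith
    show "n * search_cost n (n * n) K \<le> n * Y"
      unfolding Y_def by (rule mult_left_mono[OF search_cost_le[OF n]]) simp
  qed
  also have "\<dots> \<le> n * Y + n * Y"
  proof -
    have "128 * n \<le> n ^ 7 * n" using p[of 7] by (intro mult_right_mono) auto
    also have "\<dots> = n ^ 8" by (simp flip: power_Suc2)
    also have "\<dots> \<le> Y" unfolding Y_def using n by (intro power_increasing) auto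
    finally have "n * (128 * n) \<le> n * Y" by (intro mult_left_mono) auto
    then show ?thesis by simp
  qed
  also have "\<dots> = 2 * (n * Y)" by simp
  also have "\<dots> \<le> n * (n * Y)" using n by (intro mult_right_mono) auto
  also have "\<dots> = n ^ 2 * Y" by (simp add: power2_eq_square)
  also have "\<dots> \<le> n ^ 14 * Y" using n by (intro mult_right_mono power_increasing) auto
  also have "\<dots> = n ^ (14 * (K + 2))" unfolding Y_def by (simp flip: power_add)
  finally show ?thesis .
qed

section \<open>The exponent and the approximation ratio\<close>

text \<open>For \<open>k \<le> 4 / \<epsilon> + 1\<close> the exponent \<open>182 * k + 210\<close>
  is at most \<open>728 / \<epsilon> + 392\<close>, and for \<open>\<epsilon> < 1\<close> the
  constant is at most \<open>392 / \<epsilon>\<close>.\<close>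

lemma exponent_bigo:
  "(\<lambda>\<epsilon>::real. real (14 * (13 * (nat \<lceil>4 / \<epsilon>\<rceil> + 1) + 2))) \<in> O[at_right 0](\<lambda>\<epsilon>. 1 / \<epsilon>)"
proof (rule bigoI)
  have "norm (real (14 * (13 * (nat \<lceil>4 / \<epsilon>\<rceil> + 1) + 2))) \<le> 1120 * norm (1 / \<epsilon>)" if "0 < \<epsilon>" "\<epsilon> < 1" for \<epsilon> :: real
  proof -
    define k where "k = nat \<lceil>4 / \<epsilon>\<rceil>"
    have "real k \<le> 4 / \<epsilon> + 1" using that by (simp add: k_def)
    then have "real k \<le> 4 * (1 / \<epsilon>) + 1" by simp
    moreover have "1 \<le> 1 / \<epsilon>" using that by simp
    moreover have "real (14 * (13 * (k + 1) + 2)) = 182 * real k + 210" by simp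
    ultimately have "real (14 * (13 * (k + 1) + 2)) \<le> 1120 * (1 / \<epsilon>)" by linarith
    moreover have "norm (1 / \<epsilon>) = 1 / \<epsilon>" using that by simp
    ultimately show ?thesis by (simp only: k_def[symmetric] norm_of_nat)
  qed
  then show "\<forall>\<^sub>F \<epsilon>::real in at_right 0. norm (real (14 * (13 * (nat \<lceil>4 / \<epsilon>\<rceil> + 1) + 2))) \<le> 1120 * norm (1 / \<epsilon>)"
    unfolding eventually_at_right_field by (intro exI[of _ 1]) auto
qed

theorem theorem6:
  "\<exists>p :: real \<Rightarrow> real. p \<in> O[at_right 0](\<lambda>\<epsilon>. 1 / \<epsilon>) \<and>
     (\<forall>\<epsilon> > 0. \<exists>c :: com. \<forall>(n :: nat) E. bipartite_instance n E \<longrightarrow>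
        (\<exists>t s. exec c (input_state n E) t s \<and>
           (n \<ge> 2 \<longrightarrow> real t \<le> real n powr p \<epsilon>) \<and>
           consecutive_matching E (output_edges n s) \<and>
           (\<forall>OPT. max_consecutive_matching E OPT \<longrightarrow>
              (2 + \<epsilon>) * real (card (output_edges n s)) \<ge> real (card OPT))))"
proof (rule exI[of _ "(\<lambda>\<epsilon>. real (14 * (13 * (nat \<lceil>4 / \<epsilon>\<rceil> + 1) + 2)))"], rule conjI)
  show "(\<lambda>\<epsilon>. real (14 * (13 * (nat \<lceil>4 / \<epsilon>\<rceil> + 1) + 2))) \<in> O[at_right 0](\<lambda>\<epsilon>::real. 1 / \<epsilon>)"
    by (rule exponent_bigo)
next
  show "\<forall>\<epsilon>>0. \<exists>c :: com. \<forall>(n :: nat) E. bipartite_instance n E \<longrightarrow>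
        (\<exists>t s. exec c (input_state n E) t s \<and>
           (n \<ge> 2 \<longrightarrow> real t \<le> real n powr real (14 * (13 * (nat \<lceil>4 / \<epsilon>\<rceil> + 1) + 2))) \<and>
           consecutive_matching E (output_edges n s) \<and>
           (\<forall>OPT. max_consecutive_matching E OPT \<longrightarrow>
              (2 + \<epsilon>) * real (card (output_edges n s)) \<ge> real (card OPT)))"
  proof (intro allI impI)
    fix \<epsilon> :: real assume \<epsilon>: "0 < \<epsilon>"
    \<comment> \<open>The bound for local optima is applied to \<open>t + 1\<close>, where its ratio
      is \<open>2 * (t + 2) / t\<close>, that is, \<open>2 + 4 / t\<close>. The choice of
      \<open>t\<close> makes this at most \<open>2 + \<epsilon>\<close>.\<close>
    define t where "t = nat \<lceil>4 / \<epsilon>\<rceil>"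
    define K where "K = 13 * (t + 1)"
    have t: "4 / \<epsilon> \<le> real t" unfolding t_def by linarith
    then have t0: "0 < t" using \<epsilon> by (cases "t = 0") (auto simp: field_simps)
    show "\<exists>c :: com. \<forall>(n :: nat) E. bipartite_instance n E \<longrightarrow>
          (\<exists>t s. exec c (input_state n E) t s \<and>
             (n \<ge> 2 \<longrightarrow> real t \<le> real n powr real (14 * (13 * (nat \<lceil>4 / \<epsilon>\<rceil> + 1) + 2))) \<and>
             consecutive_matching E (output_edges n s) \<and>
             (\<forall>OPT. max_consecutive_matching E OPT \<longrightarrow>
                (2 + \<epsilon>) * real (card (output_edges n s)) \<ge> real (card OPT)))"
    proof (rule exI[of _ "algorithm K"], intro allI impI)
      fix n E assume E: "bipartite_instance n E"
      then have finE: "finite E" using finite_subset unfolding bipartite_instance_def by blast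
      from runs_algorithm[OF E, of K] obtain u s where u: "exec (algorithm K) (input_state n E) u s" "u \<le> total_cost n K"
        and M: "consecutive_matching E (output_edges n s)"
        and best: "\<And>Y. Y \<in> candidates E K (output_edges n s) \<Longrightarrow> card Y \<le> card (output_edges n s)"
        unfolding runs_def by blast
      have "real u \<le> real n powr real (14 * (K + 2))" if n: "2 \<le> n"
      proof -
        have "u \<le> n ^ (14 * (K + 2))" using u(2) total_cost_le[OF n, of K] by linarith
        then have "real u \<le> real n ^ (14 * (K + 2))" by (metis of_nat_le_iff of_nat_power)
        also have "\<dots> = real n powr real (14 * (K + 2))" using n by (subst powr_realpow) auto
        finally show ?thesis .
      qed
      moreover have "(2 + \<epsilon>) * real (card (output_edges n s)) \<ge> real (card OPT)" if OPT: "max_consecutive_matching E OPT" for OPT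
      proof -
        let ?M = "output_edges n s"
        have "(int (t + 1) - 1) * int (card OPT) \<le> 2 * (int (t + 1) + 1) * int (card ?M)"
        proof (rule local_optimum_bound[OF finE M])
          show "consecutive_matching E OPT" using OPT by (simp add: max_consecutive_matching_def)
          show "card S \<le> card {e \<in> ?M. \<exists>f\<in>S. near e f}" if "consecutive_matching E S" "card S \<le> K" for S
            by (rule candidates_local_optimum[OF finE M best that])
        qed (use t0 in \<open>auto simp: K_def\<close>)
        then have "real_of_int (int t * int (card OPT)) \<le> real_of_int (2 * (int t + 2) * int (card ?M))"
          by (subst of_int_le_iff) (simp add: algebra_simps)
        then have "real t * real (card OPT) \<le> (2 * real t + 4) * real (card ?M)"
          by (simp add: algebra_simps)
        also have "\<dots> \<le> (2 * real t + \<epsilon> * real t) * real (card ?M)"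
          using t \<epsilon> by (intro mult_right_mono) (auto simp: field_simps)
        also have "\<dots> = real t * ((2 + \<epsilon>) * real (card ?M))" by (simp add: algebra_simps)
        finally show ?thesis using t0 by simp
      qed
      ultimately show "\<exists>t s. exec (algorithm K) (input_state n E) t s \<and>
             (n \<ge> 2 \<longrightarrow> real t \<le> real n powr real (14 * (13 * (nat \<lceil>4 / \<epsilon>\<rceil> + 1) + 2))) \<and>
             consecutive_matching E (output_edges n s) \<and>
             (\<forall>OPT. max_consecutive_matching E OPT \<longrightarrow>
                (2 + \<epsilon>) * real (card (output_edges n s)) \<ge> real (card OPT))"
        using u(1) M unfolding K_def t_def by blast
    qed
  qed
qed

end
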